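(* Let $B_0$ be a finite set of nonzero polynomials in $R[x_1,\dots,x_n]$. Consider the completion procedure: given the current finite basis $B_i$, compute the G-polynomials and M-polynomials of $B_i$ and a normal form of each of them using $B_i$, and let $B_{i+1}$ be obtained from $B_i$ by adding all the nonzero normal forms; repeat until no new polynomials are added. Then this procedure terminates, and the final basis is a weak Gröbner basis of the ideal $(B_0)$; if moreover the function Gröbner gives strong Gröbner bases on $R$, the final basis is a strong Gröbner basis of $(B_0)$.
   Context: Ring and reduction. $R$ is a commutative ring with $1$. There is a reduction relation on $R$: for $a,c\in R$ and a finite nonempty set $\{b_1,\dots,b_k\}\subseteq R$ one may have "$a\to c$ using $\{b_1,\dots,b_k\}$" (if $k=1$: "$a\to c$ by $b_1$"). We say $a$ reduces using (or by) a set if $a\to c$ using it for some $c$. For $B\subseteq R$, a reduction step using $B$ is a step using some finite nonempty subset of $B$; $a$ is in normal form using $B$ if no reduction step using $B$ applies to it; a normal form of $a$ using $B$ is an element in normal form reachable from $a$ by finitely many (possibly zero) steps using $B$. The relation $\to$ (steps using arbitrary elements of $R$) is well-founded, i.e. there is no infinite sequence of steps, and satisfies: (i) a nonzero $a$ reduces to $0$ by $b$ if $a$ is a multiple of $b$; (ii) if $a\to c$ using $\{b_1,\dots,b_k\}$ then $a-c\in(b_1,\dots,b_k)$; (iii) if $a$ reduces using $\{b_1,\dots,b_k\}$ and each $b_i$ reduces by $\{c_1,\dots,c_j\}$, then $a$ also reduces by $\{c_1,\dots,c_j\}$. A basis (generating set) $B$ of an ideal of $R$ is a weak Gröbner basis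 if every element of the ideal has $0$ as a normal form using $B$; it is a strong Gröbner basis if every element of $R$ has a unique normal form using $B$. Every ideal of $R$ is assumed to have a finite weak Gröbner basis; Gröbner is a (computable) function sending each finite generating set of an ideal of $R$ to a finite weak Gröbner basis of that ideal, with computable representations of the given generators and the Gröbner basis elements in terms of each other. It is also assumed that a finite generating set of the module of solutions of a homogeneous linear equation over $R$ exists and can be computed. Polynomials. Terms are power products of $x_1,\dots,x_n$, with a fixed admissible total well-ordering (compatible with multiplication, $1$ least). For nonzero $p$, $HD(p)$, $HT(p)$, $HC(p)$ are its head-monomial, head-term, head-coefficient, so $HD(p)=HC(p)\cdot HT(p)$. $p\to q$ using nonzero polynomials $\{p_1,\dots,p_k\}$ iff there is a monomial $ct$ of $p$ ($p=ct+p'$, $c\neq 0$ the coefficient of $t$ in $p$) such that each $HT(p_i)$ divides $t$, say $t=t_i'\cdot HT(p_i)$, and there are $d,k_1,\dots,k_k\in R$ with $c\to d$ using $\{HC(p_1),\dots,HC(p_k)\}$, $c=\sum_i k_i\, HC(p_i)+d$ and $q=p-\sum_i k_i t_i' p_i$. A step using a set of polynomials is a step using some finite nonempty subset; normal forms are defined as for $R$. Weak (strong) Gröbner bases of an ideal of $R[x_1,\dots,x_n]$ are bases $B$ of it such that every polynomial in the ideal has $0$ as a normal form using $B$ (respectively, every polynomial in $R[x_1,\dots,x_n]$ has a unique normal form using $B$). Critical pairs. Let $F=\{p_1,\dots,p_j\}$ be a nonempty finite set of nonzero polynomials, $c_i=HC(p_i)$, $t_i=HT(p_i)$, $t=\mathrm{lcm}(t_1,\dots,t_j)=s_1t_1=\dots=s_jt_j$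 with terms $s_i$. Let $\{g_1,\dots,g_l\}=\text{Gröbner}(\{c_1,\dots,c_j\})$ and fix representations $g_i=h_{i,1}c_1+\dots+h_{i,j}c_j$ with $h_{i,r}\in R$; the G-polynomials of $F$ are $q_i=h_{i,1}s_1p_1+\dots+h_{i,j}s_jp_j$, $1\le i\le l$. Let $A_1,\dots,A_v$, with $A_i=\langle b_{i,1},\dots,b_{i,j}\rangle$, be a fixed finite generating set of the module $\{\langle a_1,\dots,a_j\rangle\in R^j : a_1c_1+\dots+a_jc_j=0\}$; the M-polynomials of $F$ are $q_i=b_{i,1}s_1p_1+\dots+b_{i,j}s_jp_j$, $1\le i\le v$. A G-polynomial (M-polynomial) of $B$ is a G-polynomial (M-polynomial) of some nonempty finite subset $F$ of $B$.
   Formalization: The strong part assumes of Gröbner, and also concludes, that congruent elements have equal normal forms; as stated it fails for 2x+1 over Z. In (iii), reducing "by {c_1,…,c_j}" allows any nonempty subset, and zero b_i need not reduce. *)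

theory Defs
  imports Complex_Main "HOL-Library.Poly_Mapping"
begin

section \<open>Ideals\<close>

definition ideal_of :: "'a::comm_ring_1 set \<Rightarrow> 'a set"
  where "ideal_of B = module.span (*) B"

definition is_ideal :: "'a::comm_ring_1 set \<Rightarrow> bool"
  where "is_ideal I \<longleftrightarrow> module.subspace (*) I"

lemma module_times: "module ((*) :: 'a::comm_ring_1 \<Rightarrow> 'a \<Rightarrow> 'a)"
  by unfold_locales (simp_all add: algebra_simps)


section \<open>Reduction, normal forms and Groebner bases\<close>

text \<open>
  A reduction relation is a predicate \<open>red\<close>, where \<open>red S a c\<close> means ``a reduces to c using S''. It is
  consulted only for finite nonempty sets \<open>S\<close>. The notions of this section are used twice, for the
  coefficient ring and for the polynomial ring.
\<close>

definition step_using :: "('a set \<Rightarrow> 'a \<Rightarrow> 'a \<Rightarrow> bool) \<Rightarrow> 'a set \<Rightarrow> 'a \<Rightarrow> 'a \<Rightarrow> bool"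
  where "step_using red B a c \<longleftrightarrow> (\<exists>S. S \<subseteq> B \<and> finite S \<and> S \<noteq> {} \<and> red S a c)"

definition reduces :: "('a set \<Rightarrow> 'a \<Rightarrow> 'a \<Rightarrow> bool) \<Rightarrow> 'a set \<Rightarrow> 'a \<Rightarrow> bool"
  where "reduces red B a \<longleftrightarrow> (\<exists>c. step_using red B a c)"

definition normal_form_of :: "('a set \<Rightarrow> 'a \<Rightarrow> 'a \<Rightarrow> bool) \<Rightarrow> 'a set \<Rightarrow> 'a \<Rightarrow> 'a \<Rightarrow> bool"
  where "normal_form_of red B a c \<longleftrightarrow> (step_using red B)\<^sup>*\<^sup>* a c \<and> \<not> reduces red B c"

definition weak_GB :: "('a::comm_ring_1 set \<Rightarrow> 'a \<Rightarrow> 'a \<Rightarrow> bool) \<Rightarrow> 'a set \<Rightarrow> 'a set \<Rightarrow> bool"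
  where "weak_GB red I B \<longleftrightarrow> ideal_of B = I \<and> (\<forall>a\<in>I. normal_form_of red B a 0)"

definition strong_GB :: "('a::comm_ring_1 set \<Rightarrow> 'a \<Rightarrow> 'a \<Rightarrow> bool) \<Rightarrow> 'a set \<Rightarrow> 'a set \<Rightarrow> bool"
  where "strong_GB red I B \<longleftrightarrow> ideal_of B = I \<and> (\<forall>a. \<exists>!c. normal_form_of red B a c)"

text \<open>
  Normal forms depend only on the residue class modulo the ideal. This does not follow from
  \<^const>\<open>strong_GB\<close>: over the integers, let a nonzero a reduce (to 0) by b exactly if b divides a. Then every
  element has a unique normal form using \<open>{2}\<close>, but 1 and 3 are congruent and both in normal form.
  Without this property strong bases of the coefficient ring do not give strong bases of the
  polynomial ring: for this same relation \<open>{2x + 1}\<close> is complete, but \<open>2x^2 + 2x\<close> has the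
  normal forms \<open>x\<close> and \<open>-x - 1\<close>.
\<close>

definition residue_class_normal_forms ::
    "('a::comm_ring_1 set \<Rightarrow> 'a \<Rightarrow> 'a \<Rightarrow> bool) \<Rightarrow> 'a set \<Rightarrow> 'a set \<Rightarrow> bool"
  where "residue_class_normal_forms red I B \<longleftrightarrow>
    (\<forall>a b c d. a - b \<in> I \<and> normal_form_of red B a c \<and> normal_form_of red B b d \<longrightarrow> c = d)"

text \<open>
  In \<open>reduces_trans\<close> ``reduces by C'' allows any nonempty subset of \<open>C\<close> to be used in the step, and
  zero elements of \<open>B\<close> are disregarded: 0 is always in normal form, because a step from 0 to \<open>c\<close> could be
  continued by a step from \<open>c\<close> to 0 by 1, so demanding that they reduce would make the axiom
  void for such \<open>B\<close>.
\<close>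

locale reduction_ring =
  fixes red :: "'a::comm_ring_1 set \<Rightarrow> 'a \<Rightarrow> 'a \<Rightarrow> bool"
  assumes well_founded: "wfp (\<lambda>c a. step_using red UNIV a c)"
    and multiple_reduces: "a \<noteq> 0 \<Longrightarrow> b dvd a \<Longrightarrow> red {b} a 0"
    and diff_in_ideal: "finite B \<Longrightarrow> B \<noteq> {} \<Longrightarrow> red B a c \<Longrightarrow> a - c \<in> ideal_of B"
    and reduces_trans: "finite B \<Longrightarrow> B \<noteq> {} \<Longrightarrow> finite C \<Longrightarrow> C \<noteq> {} \<Longrightarrow> reduces red B a \<Longrightarrow>
      (\<And>b. b \<in> B \<Longrightarrow> b \<noteq> 0 \<Longrightarrow> reduces red C b) \<Longrightarrow> reduces red C a"
    and finite_weak_GB: "is_ideal I \<Longrightarrow> \<exists>B. finite B \<and> weak_GB red I B"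

definition Groebner_function ::
    "('a::comm_ring_1 set \<Rightarrow> 'a \<Rightarrow> 'a \<Rightarrow> bool) \<Rightarrow> ('a set \<Rightarrow> 'a set) \<Rightarrow> bool"
  where "Groebner_function red Groebner \<longleftrightarrow>
    (\<forall>C. finite C \<longrightarrow> finite (Groebner C) \<and> weak_GB red (ideal_of C) (Groebner C))"


section \<open>Polynomials\<close>

text \<open>
  Power products are exponent vectors, so their product is \<open>+\<close> and the unit term is \<open>0\<close>.
  The indeterminates are indexed by the finite type \<open>'n\<close>.
\<close>

type_synonym 'n pp = "'n \<Rightarrow>\<^sub>0 nat"
type_synonym ('n, 'a) mpoly = "'n pp \<Rightarrow>\<^sub>0 'a"

definition admissible_order :: "'n::finite pp rel \<Rightarrow> bool"
  where "admissible_order ord \<longleftrightarrow> well_order_on UNIV ord \<and> (\<forall>t. (0, t) \<in> ord) \<and>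
    (\<forall>s t u. (s, t) \<in> ord \<longrightarrow> (s + u, t + u) \<in> ord)"

definition HT :: "'n::finite pp rel \<Rightarrow> ('n, 'a::comm_ring_1) mpoly \<Rightarrow> 'n pp"
  where "HT ord p = (THE t. t \<in> Poly_Mapping.keys p \<and> (\<forall>s\<in>Poly_Mapping.keys p. (s, t) \<in> ord))"

definition HC :: "'n::finite pp rel \<Rightarrow> ('n, 'a::comm_ring_1) mpoly \<Rightarrow> 'a"
  where "HC ord p = Poly_Mapping.lookup p (HT ord p)"

definition poly_red :: "('a::comm_ring_1 set \<Rightarrow> 'a \<Rightarrow> 'a \<Rightarrow> bool) \<Rightarrow> 'n::finite pp rel \<Rightarrow>
    ('n, 'a) mpoly set \<Rightarrow> ('n, 'a) mpoly \<Rightarrow> ('n, 'a) mpoly \<Rightarrow> bool"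
  where "poly_red red ord P p q \<longleftrightarrow> 0 \<notin> P \<and>
    (\<exists>t\<in>Poly_Mapping.keys p. \<exists>t' d k.
      (\<forall>f\<in>P. t = t' f + HT ord f) \<and>
      red (HC ord ` P) (Poly_Mapping.lookup p t) d \<and>
      Poly_Mapping.lookup p t = (\<Sum>f\<in>P. k f * HC ord f) + d \<and>
      q = p - (\<Sum>f\<in>P. Poly_Mapping.single (t' f) (k f) * f))"


section \<open>Critical pairs\<close>

definition lcm_pp :: "'n::finite pp set \<Rightarrow> 'n pp"
  where "lcm_pp T = Abs_poly_mapping (\<lambda>x. Max ((\<lambda>t. Poly_Mapping.lookup t x) ` T))"

lemma lookup_lcm_pp: "Poly_Mapping.lookup (lcm_pp T) x = Max ((\<lambda>t. Poly_Mapping.lookup t x) ` T)"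
  by (simp add: lcm_pp_def)

text \<open>
  Vectors in \<open>R^j\<close>, for \<open>F = {p_1, ..., p_j}\<close>, are functions on \<open>F\<close>; values outside of \<open>F\<close> are ignored.
  The difference \<open>lcm - HT p\<close> of exponent vectors is the term \<open>s\<close> with \<open>s * HT p = lcm\<close>.
\<close>

definition crit_comb :: "'n::finite pp rel \<Rightarrow> ('n, 'a::comm_ring_1) mpoly set \<Rightarrow>
    (('n, 'a) mpoly \<Rightarrow> 'a) \<Rightarrow> ('n, 'a) mpoly"
  where "crit_comb ord F a =
    (\<Sum>p\<in>F. Poly_Mapping.single (lcm_pp (HT ord ` F) - HT ord p) (a p) * p)"

text \<open>\<open>h F g p\<close> is the coefficient of \<open>HC p\<close> in the fixed representation of \<open>g\<close> belonging to \<open>F\<close>.\<close>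

definition Groebner_representation :: "'n::finite pp rel \<Rightarrow> ('a::comm_ring_1 set \<Rightarrow> 'a set) \<Rightarrow>
    (('n, 'a) mpoly set \<Rightarrow> 'a \<Rightarrow> ('n, 'a) mpoly \<Rightarrow> 'a) \<Rightarrow> bool"
  where "Groebner_representation ord Groebner h \<longleftrightarrow>
    (\<forall>F. finite F \<and> F \<noteq> {} \<and> 0 \<notin> F \<longrightarrow>
      (\<forall>g\<in>Groebner (HC ord ` F). g = (\<Sum>p\<in>F. h F g p * HC ord p)))"

definition syzygy_generators :: "'n::finite pp rel \<Rightarrow>
    (('n, 'a::comm_ring_1) mpoly set \<Rightarrow> (('n, 'a) mpoly \<Rightarrow> 'a) set) \<Rightarrow> bool"
  where "syzygy_generators ord syz \<longleftrightarrow>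
    (\<forall>F. finite F \<and> F \<noteq> {} \<and> 0 \<notin> F \<longrightarrow>
      finite (syz F) \<and>
      (\<forall>A\<in>syz F. (\<Sum>p\<in>F. A p * HC ord p) = 0) \<and>
      (\<forall>a. (\<Sum>p\<in>F. a p * HC ord p) = 0 \<longrightarrow>
        (\<exists>k. \<forall>p\<in>F. a p = (\<Sum>A\<in>syz F. k A * A p))))"

definition G_polys :: "'n::finite pp rel \<Rightarrow> ('a::comm_ring_1 set \<Rightarrow> 'a set) \<Rightarrow>
    (('n, 'a) mpoly set \<Rightarrow> 'a \<Rightarrow> ('n, 'a) mpoly \<Rightarrow> 'a) \<Rightarrow> ('n, 'a) mpoly set \<Rightarrow> ('n, 'a) mpoly set"
  where "G_polys ord Groebner h B =
    {crit_comb ord F (h F g) |F g. F \<subseteq> B \<and> finite F \<and> F \<noteq> {} \<and> g \<in> Groebner (HC ord ` F)}"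

definition M_polys :: "'n::finite pp rel \<Rightarrow>
    (('n, 'a::comm_ring_1) mpoly set \<Rightarrow> (('n, 'a) mpoly \<Rightarrow> 'a) set) \<Rightarrow>
    ('n, 'a) mpoly set \<Rightarrow> ('n, 'a) mpoly set"
  where "M_polys ord syz B = {crit_comb ord F A |F A. F \<subseteq> B \<and> finite F \<and> F \<noteq> {} \<and> A \<in> syz F}"


section \<open>The completion procedure\<close>

text \<open>
  One round leading from the basis \<open>B\<close> to the basis \<open>B'\<close>. The normal forms that are computed
  (\<open>nf\<close>) may be chosen freely and anew in every round.
\<close>

definition completion_step :: "('a::comm_ring_1 set \<Rightarrow> 'a \<Rightarrow> 'a \<Rightarrow> bool) \<Rightarrow> 'n::finite pp rel \<Rightarrow>
    ('a set \<Rightarrow> 'a set) \<Rightarrow> (('n, 'a) mpoly set \<Rightarrow> 'a \<Rightarrow> ('n, 'a) mpoly \<Rightarrow> 'a) \<Rightarrow>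
    (('n, 'a) mpoly set \<Rightarrow> (('n, 'a) mpoly \<Rightarrow> 'a) set) \<Rightarrow>
    ('n, 'a) mpoly set \<Rightarrow> ('n, 'a) mpoly set \<Rightarrow> bool"
  where "completion_step red ord Groebner h syz B B' \<longleftrightarrow>
    (\<exists>nf. (\<forall>q \<in> G_polys ord Groebner h B \<union> M_polys ord syz B.
              normal_form_of (poly_red red ord) B q (nf q)) \<and>
          B' = B \<union> (nf ` (G_polys ord Groebner h B \<union> M_polys ord syz B) - {0}))"

text \<open>
  A final basis is one reached by a round that adds nothing.
\<close>

definition final_basis :: "('a::comm_ring_1 set \<Rightarrow> 'a \<Rightarrow> 'a \<Rightarrow> bool) \<Rightarrow> 'n::finite pp rel \<Rightarrow>
    ('a set \<Rightarrow> 'a set) \<Rightarrow> (('n, 'a) mpoly set \<Rightarrow> 'a \<Rightarrow> ('n, 'a) mpoly \<Rightarrow> 'a) \<Rightarrow>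
    (('n, 'a) mpoly set \<Rightarrow> (('n, 'a) mpoly \<Rightarrow> 'a) set) \<Rightarrow>
    ('n, 'a) mpoly set \<Rightarrow> ('n, 'a) mpoly set \<Rightarrow> bool"
  where "final_basis red ord Groebner h syz B\<^sub>0 B \<longleftrightarrow>
    (completion_step red ord Groebner h syz)\<^sup>*\<^sup>* B\<^sub>0 B \<and> completion_step red ord Groebner h syz B B"

text \<open>
  Every round can be carried out (in particular the required normal forms exist), and no run goes
  on adding polynomials forever.
\<close>

definition completion_terminates :: "('a::comm_ring_1 set \<Rightarrow> 'a \<Rightarrow> 'a \<Rightarrow> bool) \<Rightarrow> 'n::finite pp rel \<Rightarrow>
    ('a set \<Rightarrow> 'a set) \<Rightarrow> (('n, 'a) mpoly set \<Rightarrow> 'a \<Rightarrow> ('n, 'a) mpoly \<Rightarrow> 'a) \<Rightarrow>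
    (('n, 'a) mpoly set \<Rightarrow> (('n, 'a) mpoly \<Rightarrow> 'a) set) \<Rightarrow> ('n, 'a) mpoly set \<Rightarrow> bool"
  where "completion_terminates red ord Groebner h syz B\<^sub>0 \<longleftrightarrow>
    (\<forall>B. (completion_step red ord Groebner h syz)\<^sup>*\<^sup>* B\<^sub>0 B \<longrightarrow>
      finite B \<and> (\<exists>B'. completion_step red ord Groebner h syz B B')) \<and>
    (\<forall>Bs. Bs 0 = B\<^sub>0 \<and> (\<forall>i. completion_step red ord Groebner h syz (Bs i) (Bs (Suc i))) \<longrightarrow>
      (\<exists>N. Bs (Suc N) = Bs N))"

end

theory Submission
  imports Defs "HOL-Library.Multiset"
begin

text \<open>
  A polynomial reduces using a basis \<open>B\<close> exactly if, for some term \<open>t\<close> occurring in it, the coefficient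
  of \<open>t\<close> reduces using the head-coefficients of \<open>head_divisors B t\<close>, the elements of \<open>B\<close> whose
  head-term divides \<open>t\<close> (\<open>poly_reduces_iff\<close>). Everything about reduction of polynomials thereby becomes a
  question about these sets of head-coefficients in the coefficient ring. The two kinds of critical
  polynomials answer two different questions.

  The G-polynomials make the head-coefficients strong enough for reduction. The G-polynomial of \<open>F\<close>
  belonging to \<open>g\<close> has coefficient \<open>g\<close> at the least common multiple \<open>l\<close> of the head-terms of \<open>F\<close>, and
  no larger terms. If \<open>g\<close> does not reduce using the head-coefficients available at \<open>l\<close>, then no
  reduction can change that coefficient, so the normal form has head-monomial \<open>g l\<close> and is added to the
  basis. After one pass, therefore, whatever reduces using the Groebner basis of the head-coefficients
  of \<open>F\<close> reduces using the head-coefficients available at \<open>l\<close>, and this includes every nonzero element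
  of the ideal they generate (\<open>groebner_reducible_imp_head_coefs_reduce\<close>).

  This gives termination (\<open>completion_stops\<close>). An infinite run adds in each pass a polynomial that is
  irreducible by the basis it extends. By Dickson's lemma a subsequence of these polynomials has head-terms
  ascending by divisibility, and by finite generation of ideals all its head-coefficients lie in the
  ideal of those of an initial segment \<open>F\<close>. The least common multiple of the head-terms of \<open>F\<close> divides
  all later head-terms, so as soon as the G-polynomials of \<open>F\<close> have been treated every later member
  is reducible when it is added.

  The M-polynomials control the ideal. A combination of the elements of a basis whose leading terms
  cancel does so by a syzygy of head-coefficients, hence it can be rewritten by M-polynomials; these
  reduce to 0 in a final basis, and so are combinations with smaller terms. By well-foundedness of the
  term order, every nonzero \<open>p\<close> in the ideal of a final basis has a term \<open>t\<close> whose coefficient lies in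
  the ideal of the head-coefficients of \<open>head_divisors B t\<close> (\<open>ideal_member_has_head_coef\<close>). By the
  effect of the G-polynomials, \<open>p\<close> is reducible; with well-foundedness of reduction (\<open>poly_red_wf\<close>) this
  is the weak Groebner property. For the strong one, apply the same to the difference of two distinct
  normal forms \<open>p\<close> and \<open>q\<close> of congruent polynomials: at \<open>t\<close> their coefficients differ, are congruent
  modulo the ideal of head-coefficients, and are irreducible by its Groebner basis, which contradicts the
  assumption on the coefficient ring.
\<close>

section \<open>Ideals and abstract reduction\<close>

lemma ideal_of_base: "b \<in> B \<Longrightarrow> b \<in> ideal_of B"
  unfolding ideal_of_def by (rule module.span_base[OF module_times])

lemma ideal_of_zero: "0 \<in> ideal_of B"
  unfolding ideal_of_def by (rule module.span_zero[OF module_times])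

lemma ideal_of_add: "a \<in> ideal_of B \<Longrightarrow> b \<in> ideal_of B \<Longrightarrow> a + b \<in> ideal_of B"
  unfolding ideal_of_def by (rule module.span_add[OF module_times])

lemma ideal_of_diff: "a \<in> ideal_of B \<Longrightarrow> b \<in> ideal_of B \<Longrightarrow> a - b \<in> ideal_of B"
  unfolding ideal_of_def by (rule module.span_diff[OF module_times])

lemma ideal_of_mult: "a \<in> ideal_of B \<Longrightarrow> c * a \<in> ideal_of B"
  unfolding ideal_of_def by (rule module.span_scale[OF module_times])

lemma ideal_of_sum: "(\<And>x. x \<in> X \<Longrightarrow> f x \<in> ideal_of B) \<Longrightarrow> (\<Sum>x\<in>X. f x) \<in> ideal_of B"
  unfolding ideal_of_def by (rule module.span_sum[OF module_times])

lemma ideal_of_mono: "B \<subseteq> C \<Longrightarrow> ideal_of B \<subseteq> ideal_of C"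
  unfolding ideal_of_def by (rule module.span_mono[OF module_times])

lemma ideal_of_empty: "ideal_of {} = {0}"
  unfolding ideal_of_def by (rule module.span_empty[OF module_times])

lemma ideal_of_subset: "B \<subseteq> ideal_of C \<Longrightarrow> ideal_of B \<subseteq> ideal_of C"
  unfolding ideal_of_def
  by (rule module.span_minimal[OF module_times _ module.subspace_span[OF module_times]])

lemma ideal_of_image_explicit:
  assumes "x \<in> ideal_of (g ` P)" and "finite P"
  shows "\<exists>k. x = (\<Sum>f\<in>P. k f * g f)"
  using assms(1) unfolding ideal_of_def
proof (induction rule: module.span_induct_alt[OF module_times, consumes 1, case_names base step])
  case base
  show ?case by (rule exI[of _ "\<lambda>_. 0"]) simp
next
  case (step c x y)
  then obtain f\<^sub>0 k where "f\<^sub>0 \<in> P" "x = g f\<^sub>0" "y = (\<Sum>f\<in>P. k f * g f)" by blast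
  then have "c * x + y = (\<Sum>f\<in>P. (k f + (if f = f\<^sub>0 then c else 0)) * g f)"
    using assms(2) by (simp add: distrib_right sum.distrib if_distrib[of "\<lambda>a. a * _"] cong: if_cong)
  then show ?case by (rule exI[where x = "\<lambda>f. k f + (if f = f\<^sub>0 then c else 0)"])
qed

lemma ideal_of_finite_support:
  assumes "x \<in> ideal_of B"
  obtains S where "finite S" "S \<subseteq> B" "x \<in> ideal_of S"
proof -
  obtain S r where S: "finite S" "S \<subseteq> B" and x: "x = (\<Sum>a\<in>S. r a * a)"
    using assms unfolding ideal_of_def module.span_explicit[OF module_times] by blast
  have "x \<in> ideal_of S"
    unfolding x by (intro ideal_of_sum ideal_of_mult ideal_of_base)
  then show thesis using S that by blast
qed

lemma step_usingI: "red S a c \<Longrightarrow> S \<subseteq> B \<Longrightarrow> finite S \<Longrightarrow> S \<noteq> {} \<Longrightarrow> step_using red B a c"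
  unfolding step_using_def by (rule exI[of _ S]) simp

lemma step_using_mono: "step_using red B a c \<Longrightarrow> B \<subseteq> C \<Longrightarrow> step_using red C a c"
  unfolding step_using_def by (meson order_trans)

lemma reducesI: "red S a c \<Longrightarrow> S \<subseteq> B \<Longrightarrow> finite S \<Longrightarrow> S \<noteq> {} \<Longrightarrow> reduces red B a"
  unfolding reduces_def by (rule exI, rule step_usingI)

lemma reduces_mono: "reduces red B a \<Longrightarrow> B \<subseteq> C \<Longrightarrow> reduces red C a"
  unfolding reduces_def using step_using_mono by metis

lemma normal_form_exists:
  assumes "wfp (\<lambda>c a. step_using red UNIV a c)"
  shows "\<exists>c. normal_form_of red B a c"
  using assms
proof (induction a rule: wfp_induct_rule)
  case (less a)
  show ?case
  proof (cases "reduces red B a")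
    case True
    then obtain b where b: "step_using red B a b" unfolding reduces_def by blast
    then have "step_using red UNIV a b" by (rule step_using_mono) simp
    from less[OF this] obtain c where "normal_form_of red B b c" by blast
    with b have "normal_form_of red B a c"
      unfolding normal_form_of_def by (meson converse_rtranclp_into_rtranclp)
    then show ?thesis by blast
  next
    case False
    then show ?thesis unfolding normal_form_of_def by blast
  qed
qed

lemma steps_congruent:
  assumes "\<And>a c. step_using red B a c \<Longrightarrow> a - c \<in> ideal_of B"
    and "(step_using red B)\<^sup>*\<^sup>* a c"
  shows "a - c \<in> ideal_of B"
  using assms(2)
proof induction
  case base
  show ?case by (simp add: ideal_of_zero)
next
  case (step b c)
  from ideal_of_add[OF step.IH assms(1)[OF step.hyps(2)]] show ?case by simp
qed

lemma weak_GB_reduces: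
  assumes "weak_GB red I G" "a \<in> I" "a \<noteq> 0"
  shows "reduces red G a"
proof -
  have "(step_using red G)\<^sup>*\<^sup>* a 0"
    using assms unfolding weak_GB_def normal_form_of_def by blast
  then show ?thesis
    using assms(3) unfolding reduces_def by (meson converse_rtranclpE)
qed

context reduction_ring
begin

text \<open>
  If 0 could be reduced to \<open>c\<close>, then \<open>c\<close> would be nonzero and could be reduced to 0 by 1, giving an
  infinite sequence of steps.
\<close>

lemma zero_irreducible: "\<not> reduces red B 0"
proof
  assume "reduces red B 0"
  then obtain c where c: "step_using red UNIV 0 c"
    unfolding reduces_def using step_using_mono subset_UNIV by metis
  then have "c \<noteq> 0"
    using well_founded by (metis wfp_imp_irreflp irreflpD)
  then have "red {1} c 0"
    by (rule multiple_reduces) simp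
  then have "step_using red UNIV c 0"
    by (rule step_usingI) simp_all
  then show False
    using c well_founded by (metis wfp_imp_asymp asympD)
qed

lemma step_irreflexive: "\<not> step_using red B a a"
proof
  assume "step_using red B a a"
  then have "step_using red UNIV a a" by (rule step_using_mono) simp
  then show False using well_founded by (metis wfp_imp_irreflp irreflpD)
qed

text \<open>
  The coefficient ring is Noetherian, because every ideal has a finite basis.
\<close>

lemma ideal_sequence_stabilises:
  fixes c :: "nat \<Rightarrow> 'a"
  shows "\<exists>M. \<forall>i. c i \<in> ideal_of (c ` {..<M})"
proof -
  have "is_ideal (ideal_of (range c))"
    unfolding is_ideal_def ideal_of_def by (rule module.subspace_span[OF module_times])
  then obtain G where G: "finite G" "ideal_of G = ideal_of (range c)"
    using finite_weak_GB unfolding weak_GB_def by blast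
  have "\<exists>M. g \<in> ideal_of (c ` {..<M})" if "g \<in> G" for g
  proof -
    have "g \<in> ideal_of (range c)" using G(2) ideal_of_base[OF that] by simp
    then obtain S where S: "finite S" "S \<subseteq> range c" "g \<in> ideal_of S"
      by (rule ideal_of_finite_support)
    obtain J where J: "finite J" "S = c ` J"
      using finite_subset_image[OF S(1,2)] by blast
    obtain M where "\<forall>j\<in>J. j < M"
      using J(1) finite_nat_set_iff_bounded by blast
    then have "S \<subseteq> c ` {..<M}" using J(2) by auto
    then show ?thesis using S(3) ideal_of_mono by blast
  qed
  then obtain m where m: "\<And>g. g \<in> G \<Longrightarrow> g \<in> ideal_of (c ` {..<m g})" by metis
  obtain M where M: "\<forall>k\<in>m ` G. k < M"
    using G(1) finite_nat_set_iff_bounded by (meson finite_imageI)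
  have "G \<subseteq> ideal_of (c ` {..<M})"
  proof
    fix g assume g: "g \<in> G"
    have "c ` {..<m g} \<subseteq> c ` {..<M}" using M g by (force intro!: image_mono)
    then show "g \<in> ideal_of (c ` {..<M})" using m[OF g] ideal_of_mono by blast
  qed
  then have "ideal_of (range c) \<subseteq> ideal_of (c ` {..<M})"
    using G(2) ideal_of_subset by metis
  then show ?thesis using ideal_of_base by (metis rangeI subsetD)
qed

end


section \<open>Power products\<close>

abbreviation coef where "coef \<equiv> Poly_Mapping.lookup"
abbreviation supp where "supp \<equiv> Poly_Mapping.keys"

text \<open>
  Divisibility of terms is written as the existence of a cofactor, since power products are
  written additively.
\<close>

lemma pp_divides_iff:
  fixes s t :: "'n pp"
  shows "(\<exists>u. t = u + s) \<longleftrightarrow> (\<forall>x. coef s x \<le> coef t x)"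
proof
  assume "\<forall>x. coef s x \<le> coef t x"
  then have "t = (t - s) + s"
    by (intro poly_mapping_eqI) (simp add: lookup_add minus_poly_mapping.rep_eq)
  then show "\<exists>u. t = u + s" by blast
qed (auto simp: lookup_add)

lemma pp_diff_add:
  fixes s t :: "'n pp"
  assumes "\<exists>u. t = u + s"
  shows "t - s + s = t"
  using assms by auto

lemma lcm_pp_divisible:
  assumes "finite T" "t \<in> T"
  shows "\<exists>u. lcm_pp T = u + t"
  unfolding pp_divides_iff lookup_lcm_pp using assms by auto

lemma lcm_pp_least:
  assumes "finite T" "T \<noteq> {}" "\<And>t. t \<in> T \<Longrightarrow> \<exists>u. s = u + t"
  shows "\<exists>u. s = u + lcm_pp T"
proof -
  have "\<forall>x. coef t x \<le> coef s x" if "t \<in> T" for t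
    using assms(3)[OF that] unfolding pp_divides_iff .
  then show ?thesis
    unfolding pp_divides_iff lookup_lcm_pp using assms(1,2) by simp
qed

lemma nat_sequence_ascends:
  fixes s :: "nat \<Rightarrow> nat"
  shows "\<exists>r::nat \<Rightarrow> nat. strict_mono r \<and> (\<forall>i j. i \<le> j \<longrightarrow> s (r i) \<le> s (r j))"
proof -
  obtain f :: "nat \<Rightarrow> nat" where f: "strict_mono f" "monoseq (\<lambda>n. s (f n))"
    using seq_monosub by blast
  show ?thesis
  proof (cases "\<forall>m n. m \<le> n \<longrightarrow> s (f m) \<le> s (f n)")
    case True
    then show ?thesis using f(1) by blast
  next
    case False
    then have dec: "s (f n) \<le> s (f m)" if "m \<le> n" for m n
      using f(2) that unfolding monoseq_def by blast
    obtain N where N: "\<And>n. s (f N) \<le> s (f n)"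
      using ex_has_least_nat[of "\<lambda>_. True" 0 "\<lambda>n. s (f n)"] by blast
    have "s (f (N + n)) = s (f N)" for n
      using N dec by (simp add: antisym)
    moreover have "strict_mono (\<lambda>n. f (N + n))"
      using f(1) by (simp add: strict_mono_def)
    ultimately show ?thesis
      by (intro exI[of _ "\<lambda>n. f (N + n)"]) simp
  qed
qed

text \<open>
  Pass to a subsequence once for each indeterminate.
\<close>

lemma Dickson:
  fixes s :: "nat \<Rightarrow> 'n::finite pp"
  shows "\<exists>r::nat \<Rightarrow> nat. strict_mono r \<and> (\<forall>i j. i \<le> j \<longrightarrow> (\<exists>u. s (r j) = u + s (r i)))"
proof -
  have "\<exists>r::nat \<Rightarrow> nat. strict_mono r \<and> (\<forall>x\<in>X. \<forall>i j. i \<le> j \<longrightarrow> coef (s (r i)) x \<le> coef (s (r j)) x)"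
    if "finite X" for X :: "'n set"
    using that
  proof induction
    case empty
    show ?case by (rule exI[of _ id]) (simp add: strict_mono_def)
  next
    case (insert x X)
    then obtain r :: "nat \<Rightarrow> nat" where r: "strict_mono r"
      "\<And>y i j. y \<in> X \<Longrightarrow> i \<le> j \<Longrightarrow> coef (s (r i)) y \<le> coef (s (r j)) y" by blast
    obtain q :: "nat \<Rightarrow> nat" where q: "strict_mono q"
      "\<And>i j. i \<le> j \<Longrightarrow> coef (s (r (q i))) x \<le> coef (s (r (q j))) x"
      using nat_sequence_ascends[of "\<lambda>n. coef (s (r n)) x"] by blast
    have "q i \<le> q j" if "i \<le> j" for i j
      using q(1) that by (simp add: strict_mono_less_eq)
    then have "\<forall>y\<in>insert x X. \<forall>i j. i \<le> j \<longrightarrow> coef (s (r (q i))) y \<le> coef (s (r (q j))) y"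
      using r(2) q(2) by blast
    moreover have "strict_mono (\<lambda>n. r (q n))"
      using r(1) q(1) by (simp add: strict_mono_def)
    ultimately show ?case by (intro exI[of _ "\<lambda>n. r (q n)"]) simp
  qed
  from this[of UNIV] show ?thesis unfolding pp_divides_iff by auto
qed

lemma single_sum: "Poly_Mapping.single t (\<Sum>x\<in>X. f x) = (\<Sum>x\<in>X. Poly_Mapping.single t (f x))"
  by (induction X rule: infinite_finite_induct) (simp_all add: single_add)

lemma lookup_monom_mult:
  fixes f :: "('n, 'a::comm_ring_1) mpoly"
  shows "coef (Poly_Mapping.single t k * f) (t + s) = k * coef f s"
  by (simp add: lookup_mult lookup_single when_mult)

lemma supp_monom_mult:
  fixes f :: "('n, 'a::comm_ring_1) mpoly"
  assumes "u \<in> supp (Poly_Mapping.single t k * f)"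
  shows "\<exists>s\<in>supp f. u = t + s"
  using assms keys_mult[of "Poly_Mapping.single t k" f] by (force split: if_splits)

locale term_order =
  fixes ord :: "'n::finite pp rel"
  assumes admissible: "admissible_order ord"
begin

lemma ord_refl: "(t, t) \<in> ord"
  using admissible
  by (simp add: admissible_order_def well_order_on_def linear_order_on_def partial_order_on_def
      preorder_on_def refl_on_def)

lemma ord_trans: "(s, t) \<in> ord \<Longrightarrow> (t, u) \<in> ord \<Longrightarrow> (s, u) \<in> ord"
  using admissible unfolding admissible_order_def well_order_on_def linear_order_on_def
    partial_order_on_def preorder_on_def by (blast dest: transD)

lemma ord_antisym: "(s, t) \<in> ord \<Longrightarrow> (t, s) \<in> ord \<Longrightarrow> s = t"
  using admissible unfolding admissible_order_def well_order_on_def linear_order_on_def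
    partial_order_on_def by (blast dest: antisymD)

lemma ord_total: "(s, t) \<in> ord \<or> (t, s) \<in> ord"
proof -
  have "total ord"
    using admissible by (simp add: admissible_order_def well_order_on_def linear_order_on_def)
  then show ?thesis using ord_refl by (cases "s = t") (simp_all add: total_on_def)
qed

lemma ord_wf: "wf (ord - Id)"
  using admissible by (simp add: admissible_order_def well_order_on_def)

lemma ord_add: "(s, t) \<in> ord \<Longrightarrow> (u + s, u + t) \<in> ord"
  using admissible unfolding admissible_order_def by (metis add.commute)

definition lt :: "'n pp \<Rightarrow> 'n pp \<Rightarrow> bool"
  where "lt s t \<longleftrightarrow> (s, t) \<in> ord \<and> s \<noteq> t"

lemma ord_lt_trans: "(s, t) \<in> ord \<Longrightarrow> lt t u \<Longrightarrow> lt s u"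
  unfolding lt_def using ord_trans ord_antisym by blast

lemma lt_add: "lt s t \<Longrightarrow> lt (u + s) (u + t)"
  unfolding lt_def using ord_add by simp

lemma finite_has_maximum:
  assumes "finite A" "A \<noteq> {}"
  shows "\<exists>m\<in>A. \<forall>s\<in>A. (s, m) \<in> ord"
  using assms
proof (induction rule: finite_ne_induct)
  case (singleton x)
  show ?case by (simp add: ord_refl)
next
  case (insert x A)
  then obtain m where "m \<in> A" "\<forall>s\<in>A. (s, m) \<in> ord" by blast
  then show ?case using ord_total[of x m] ord_trans ord_refl by (metis insert_iff)
qed

lemma HT_unique:
  assumes "t \<in> supp p" "\<And>s. s \<in> supp p \<Longrightarrow> (s, t) \<in> ord"
  shows "HT ord p = t"
  unfolding HT_def using assms ord_antisym by (intro the_equality) blast+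

lemma
  assumes "p \<noteq> 0"
  shows HT_in_supp: "HT ord p \<in> supp p"
    and HT_greatest: "s \<in> supp p \<Longrightarrow> (s, HT ord p) \<in> ord"
proof -
  obtain m where "m \<in> supp p" "\<forall>s\<in>supp p. (s, m) \<in> ord"
    using finite_has_maximum[of "supp p"] assms by auto
  then show "HT ord p \<in> supp p" "s \<in> supp p \<Longrightarrow> (s, HT ord p) \<in> ord"
    using HT_unique by auto
qed

lemma HC_nonzero: "p \<noteq> 0 \<Longrightarrow> HC ord p \<noteq> 0"
  unfolding HC_def using HT_in_supp by (simp add: in_keys_iff)

lemma lookup_monom_mult_HT: "coef (Poly_Mapping.single t k * f) (t + HT ord f) = k * HC ord f"
  unfolding HC_def by (rule lookup_monom_mult)

lemma supp_monom_mult_le: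
  fixes f :: "('n, 'a::comm_ring_1) mpoly"
  assumes "u \<in> supp (Poly_Mapping.single t k * f)"
  shows "(u, t + HT ord f) \<in> ord"
proof -
  obtain s where s: "s \<in> supp f" "u = t + s" using supp_monom_mult[OF assms] by blast
  then have "f \<noteq> 0" by auto
  then show ?thesis using s HT_greatest ord_add by blast
qed

definition head_divisors :: "('n, 'a::comm_ring_1) mpoly set \<Rightarrow> 'n pp \<Rightarrow> ('n, 'a) mpoly set"
  where "head_divisors B t = {f \<in> B. \<exists>u. t = u + HT ord f}"

lemma head_divisors_mono:
  assumes "B \<subseteq> B'" "\<exists>u. t = u + s"
  shows "head_divisors B s \<subseteq> head_divisors B' t"
proof
  fix f assume "f \<in> head_divisors B s"
  then obtain v where f: "f \<in> B" "s = v + HT ord f" unfolding head_divisors_def by blast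
  obtain u where "t = u + s" using assms(2) by blast
  then have "t = (u + v) + HT ord f" using f(2) by (simp add: add.assoc)
  then show "f \<in> head_divisors B' t" using f(1) assms(1) unfolding head_divisors_def by blast
qed

text \<open>
  All summands of a critical combination have been lifted to the same head-term, the least common
  multiple. Its coefficient there is \<open>g\<close> for the G-polynomial belonging to \<open>g\<close>, and 0 for
  M-polynomials.
\<close>

lemma
  assumes "finite F" "F \<noteq> {}" "0 \<notin> F"
  shows lookup_crit_comb: "coef (crit_comb ord F a) (lcm_pp (HT ord ` F)) = (\<Sum>p\<in>F. a p * HC ord p)"
    and supp_crit_comb: "u \<in> supp (crit_comb ord F a) \<Longrightarrow> (u, lcm_pp (HT ord ` F)) \<in> ord"
proof -
  let ?t = "lcm_pp (HT ord ` F)"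
  have eq: "?t - HT ord p + HT ord p = ?t" if "p \<in> F" for p
    using assms(1) that by (intro pp_diff_add lcm_pp_divisible) auto
  show "coef (crit_comb ord F a) ?t = (\<Sum>p\<in>F. a p * HC ord p)"
    unfolding crit_comb_def lookup_sum
  proof (rule sum.cong[OF refl])
    fix p assume "p \<in> F"
    then show "coef (Poly_Mapping.single (?t - HT ord p) (a p) * p) ?t = a p * HC ord p"
      using lookup_monom_mult_HT[of "?t - HT ord p" "a p" p] eq by simp
  qed
  assume "u \<in> supp (crit_comb ord F a)"
  then have "(\<Sum>p\<in>F. coef (Poly_Mapping.single (?t - HT ord p) (a p) * p) u) \<noteq> 0"
    by (simp add: crit_comb_def lookup_sum in_keys_iff)
  then obtain p where p: "p \<in> F" "coef (Poly_Mapping.single (?t - HT ord p) (a p) * p) u \<noteq> 0"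
    by (rule sum.not_neutral_contains_not_neutral)
  then have "(u, ?t - HT ord p + HT ord p) \<in> ord"
    by (intro supp_monom_mult_le) (simp add: in_keys_iff)
  then show "(u, ?t) \<in> ord"
    using eq[OF p(1)] by simp
qed

lemma crit_comb_in_ideal: "F \<subseteq> B \<Longrightarrow> crit_comb ord F a \<in> ideal_of B"
  unfolding crit_comb_def by (intro ideal_of_sum ideal_of_mult ideal_of_base) blast

end


section \<open>Reduction of polynomials\<close>

locale polynomial_reduction = reduction_ring red + term_order ord
  for red :: "'a::comm_ring_1 set \<Rightarrow> 'a \<Rightarrow> 'a \<Rightarrow> bool" and ord :: "'n::finite pp rel"
begin

abbreviation "pred \<equiv> poly_red red ord"

text \<open>
  What later proofs need about a step: it is a step of the coefficient ring at one term \<open>t\<close>, it does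
  not touch terms that are not at most \<open>t\<close>, and it subtracts multiples of basis elements with
  head-term \<open>t\<close>.
\<close>

lemma poly_stepE:
  assumes "step_using pred B p q"
  obtains t P k where "t \<in> supp p" "finite P" "P \<subseteq> head_divisors B t" "0 \<notin> P"
    "step_using red (HC ord ` head_divisors B t) (coef p t) (coef q t)"
    "p - q = (\<Sum>f\<in>P. Poly_Mapping.single (t - HT ord f) (k f) * f)"
    "\<And>u. (u, t) \<notin> ord \<Longrightarrow> coef q u = coef p u"
proof -
  from assms obtain P where P: "P \<subseteq> B" "finite P" "P \<noteq> {}" "pred P p q"
    unfolding step_using_def by blast
  then obtain t t' d k where t: "t \<in> supp p" "\<And>f. f \<in> P \<Longrightarrow> t = t' f + HT ord f"
    and d: "red (HC ord ` P) (coef p t) d" "coef p t = (\<Sum>f\<in>P. k f * HC ord f) + d"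
    and q: "q = p - (\<Sum>f\<in>P. Poly_Mapping.single (t' f) (k f) * f)" and "0 \<notin> P"
    unfolding poly_red_def by blast
  have t': "t - HT ord f = t' f" if "f \<in> P" for f
    using t(2)[OF that] by simp
  have diff: "p - q = (\<Sum>f\<in>P. Poly_Mapping.single (t - HT ord f) (k f) * f)"
    unfolding q using t' by simp
  have sub: "P \<subseteq> head_divisors B t"
    using P(1) t(2) unfolding head_divisors_def by blast
  have "coef (Poly_Mapping.single (t' f) (k f) * f) t = k f * HC ord f" if "f \<in> P" for f
    using lookup_monom_mult_HT[of "t' f" "k f" f] t(2)[OF that] by simp
  then have "coef q t = d"
    unfolding q using d(2) by (simp add: lookup_minus lookup_sum)
  have st: "step_using red (HC ord ` head_divisors B t) (coef p t) (coef q t)"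
    unfolding \<open>coef q t = d\<close> by (rule step_usingI[where red = red, OF d(1)]) (use sub P(2,3) in auto)
  have "coef q u = coef p u" if "(u, t) \<notin> ord" for u
  proof -
    have "coef (Poly_Mapping.single (t' f) (k f) * f) u = 0" if "f \<in> P" for f
      using supp_monom_mult_le[of u "t' f" "k f" f] t(2)[OF that] \<open>(u, t) \<notin> ord\<close>
      by (auto simp: in_keys_iff)
    then show ?thesis unfolding q by (simp add: lookup_minus lookup_sum)
  qed
  with that[OF t(1) P(2) sub \<open>0 \<notin> P\<close> st diff] show thesis by blast
qed

lemma poly_step_congruent:
  assumes "step_using pred B p q"
  shows "p - q \<in> ideal_of B"
proof -
  obtain t P k where "P \<subseteq> head_divisors B t"
    "p - q = (\<Sum>f\<in>P. Poly_Mapping.single (t - HT ord f) (k f) * f)"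
    using assms by (rule poly_stepE)
  moreover from this have "P \<subseteq> B" unfolding head_divisors_def by blast
  ultimately show ?thesis by (auto intro!: ideal_of_sum ideal_of_mult intro: ideal_of_base)
qed

lemma poly_reduces_iff:
  assumes "0 \<notin> B"
  shows "reduces pred B p \<longleftrightarrow>
    (\<exists>t\<in>supp p. reduces red (HC ord ` head_divisors B t) (coef p t))"
proof
  assume "reduces pred B p"
  then obtain q where "step_using pred B p q" unfolding reduces_def by blast
  then show "\<exists>t\<in>supp p. reduces red (HC ord ` head_divisors B t) (coef p t)"
    unfolding reduces_def by (rule poly_stepE) blast
next
  assume "\<exists>t\<in>supp p. reduces red (HC ord ` head_divisors B t) (coef p t)"
  then obtain t S d where t: "t \<in> supp p"
    and S: "S \<subseteq> HC ord ` head_divisors B t" "finite S" "S \<noteq> {}" "red S (coef p t) d"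
    unfolding reduces_def step_using_def by blast
  obtain P where P: "P \<subseteq> head_divisors B t" "finite P" "S = HC ord ` P"
    using finite_subset_image[OF S(2,1)] by blast
  have "coef p t - d \<in> ideal_of (HC ord ` P)"
    using diff_in_ideal[OF S(2-4)] P(3) by simp
  then obtain k where k: "coef p t - d = (\<Sum>f\<in>P. k f * HC ord f)"
    using ideal_of_image_explicit P(2) by blast
  have eq: "t = (t - HT ord f) + HT ord f" if "f \<in> P" for f
    using P(1) that pp_diff_add[of t "HT ord f"] unfolding head_divisors_def by auto
  have sub: "P \<subseteq> B" using P(1) unfolding head_divisors_def by blast
  have "0 \<notin> P" using assms sub by blast
  have c: "coef p t = (\<Sum>f\<in>P. k f * HC ord f) + d"
    using k by (metis diff_add_cancel)
  have d: "red (HC ord ` P) (coef p t) d" using S(4) P(3) by simp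
  have step: "pred P p (p - (\<Sum>f\<in>P. Poly_Mapping.single (t - HT ord f) (k f) * f))"
    unfolding poly_red_def
    by (intro conjI bexI[OF _ t] exI[of _ "\<lambda>f. t - HT ord f"] exI[of _ d] exI[of _ k]
        \<open>0 \<notin> P\<close> c d refl ballI eq)
  have "P \<noteq> {}" using S(3) P(3) by blast
  from reducesI[where red = pred, OF step sub P(2) this] show "reduces pred B p" .
qed

text \<open>
  A polynomial is measured by the multiset of its pairs of term and coefficient, ordered by the multiset
  extension of the lexicographic product of the term order and reduction of coefficients. A step lowers
  or removes one pair and otherwise affects only pairs with smaller terms.
\<close>

lemma poly_red_wf: "wfp (\<lambda>q p. step_using pred UNIV p q)"
proof -
  define r where "r = (ord - Id) <*lex*> {(d, c). step_using red UNIV c d}"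
  define graph where "graph p = (\<lambda>t. (t, coef p t)) ` supp p" for p :: "('n, 'a) mpoly"
  have "wf {(d, c). step_using red UNIV c d}"
    using well_founded by (simp add: wfp_def)
  then have "wf r" unfolding r_def by (intro wf_lex_prod ord_wf)
  have fin: "finite (graph p)" for p unfolding graph_def by simp
  have "(mset_set (graph q), mset_set (graph p)) \<in> mult r" if step: "step_using pred UNIV p q" for p q
  proof -
    obtain t where t: "t \<in> supp p"
      "step_using red (HC ord ` head_divisors UNIV t) (coef p t) (coef q t)"
      "\<And>u. (u, t) \<notin> ord \<Longrightarrow> coef q u = coef p u"
      using step by (rule poly_stepE) blast
    have st: "step_using red UNIV (coef p t) (coef q t)"
      using t(2) by (rule step_using_mono) simp
    then have neq: "coef p t \<noteq> coef q t" using step_irreflexive by metis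
    then have mem: "(t, coef p t) \<in> graph p - graph q"
      using t(1) unfolding graph_def by auto
    have "\<exists>j\<in>graph p - graph q. (k, j) \<in> r" if k: "k \<in> graph q - graph p" for k
    proof -
      obtain u where u: "k = (u, coef q u)" "u \<in> supp q" "(u, coef q u) \<notin> graph p"
        using k unfolding graph_def by auto
      have "coef q u \<noteq> coef p u"
        using u(2,3) unfolding graph_def by (auto simp: in_keys_iff)
      then have "(u, t) \<in> ord" using t(3) by blast
      then have "(k, (t, coef p t)) \<in> r"
        unfolding r_def u(1) using st by auto
      then show ?thesis using mem by blast
    qed
    \<comment> \<open>Cancelling the common pairs exhibits a single step of the multiset extension.\<close>
    then have "(mset_set (graph p \<inter> graph q) + mset_set (graph q - graph p),
        mset_set (graph p \<inter> graph q) + mset_set (graph p - graph q)) \<in> mult r"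
      using mem fin by (intro one_step_implies_mult) (auto simp: mset_set_empty_iff)
    moreover have "mset_set (graph p \<inter> graph q) + mset_set (graph q - graph p) = mset_set (graph q)"
      using fin by (subst mset_set_Union[symmetric]) (auto intro!: arg_cong[of _ _ mset_set])
    moreover have "mset_set (graph p \<inter> graph q) + mset_set (graph p - graph q) = mset_set (graph p)"
      using fin by (subst mset_set_Union[symmetric]) (auto intro!: arg_cong[of _ _ mset_set])
    ultimately show ?thesis by simp
  qed
  then have "{(q, p). step_using pred UNIV p q} \<subseteq> inv_image (mult r) (\<lambda>p. mset_set (graph p))"
    by auto
  then show ?thesis
    unfolding wfp_def using wf_subset[OF wf_inv_image[OF wf_mult[OF \<open>wf r\<close>]]] by blast
qed

text \<open>
  A step at a smaller term does not reach the coefficient of \<open>t\<close>, and a step at \<open>t\<close> itself is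
  excluded by irreducibility.
\<close>

lemma steps_keep_irreducible_coef:
  assumes "(step_using pred B)\<^sup>*\<^sup>* p q"
    and "\<And>u. u \<in> supp p \<Longrightarrow> (u, t) \<in> ord"
    and "\<not> reduces red (HC ord ` head_divisors B t) (coef p t)"
  shows "coef q t = coef p t \<and> (\<forall>u\<in>supp q. (u, t) \<in> ord)"
  using assms(1)
proof induction
  case base
  show ?case using assms(2) by blast
next
  case (step q q')
  obtain s where s: "s \<in> supp q"
    "step_using red (HC ord ` head_divisors B s) (coef q s) (coef q' s)"
    "\<And>u. (u, s) \<notin> ord \<Longrightarrow> coef q' u = coef q u"
    using step.hyps(2) by (rule poly_stepE) blast
  have "s \<noteq> t" using s(2) assms(3) step.IH unfolding reduces_def by auto
  moreover have "(s, t) \<in> ord" using s(1) step.IH by blast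
  ultimately have "(t, s) \<notin> ord" using ord_antisym by blast
  then have "coef q' t = coef p t" using s(3) step.IH by simp
  moreover have "(u, t) \<in> ord" if "u \<in> supp q'" for u
  proof (cases "(u, s) \<in> ord")
    case True
    then show ?thesis using \<open>(s, t) \<in> ord\<close> ord_trans by blast
  next
    case False
    then have "u \<in> supp q" using s(3) that by (simp add: in_keys_iff)
    then show ?thesis using step.IH by blast
  qed
  ultimately show ?case by blast
qed


section \<open>Combinations of the basis with bounded terms\<close>

text \<open>
  The set \<open>T\<close> bounds the head-terms of the summands of the combination, before any cancellation. The
  case of interest is \<open>T\<close> consisting of all terms below a given one.
\<close>

definition combs :: "('n, 'a) mpoly set \<Rightarrow> 'n pp set \<Rightarrow> ('n, 'a) mpoly set"
  where "combs B T = {\<Sum>f\<in>B. a f * f | a. \<forall>f\<in>B. \<forall>s\<in>supp (a f). s + HT ord f \<in> T}"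

lemma combsI: "(\<And>f s. f \<in> B \<Longrightarrow> s \<in> supp (a f) \<Longrightarrow> s + HT ord f \<in> T) \<Longrightarrow> (\<Sum>f\<in>B. a f * f) \<in> combs B T"
  unfolding combs_def by blast

lemma combsE:
  assumes "p \<in> combs B T"
  obtains a where "p = (\<Sum>f\<in>B. a f * f)" "\<And>f s. f \<in> B \<Longrightarrow> s \<in> supp (a f) \<Longrightarrow> s + HT ord f \<in> T"
  using assms unfolding combs_def by blast

lemma combs_zero: "0 \<in> combs B T"
  using combsI[of B "\<lambda>_. 0" T] by simp

lemma combs_add:
  assumes "p \<in> combs B T" "q \<in> combs B T"
  shows "p + q \<in> combs B T"
proof -
  obtain a where a: "p = (\<Sum>f\<in>B. a f * f)" "\<And>f s. f \<in> B \<Longrightarrow> s \<in> supp (a f) \<Longrightarrow> s + HT ord f \<in> T"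
    using assms(1) by (rule combsE) blast
  obtain b where b: "q = (\<Sum>f\<in>B. b f * f)" "\<And>f s. f \<in> B \<Longrightarrow> s \<in> supp (b f) \<Longrightarrow> s + HT ord f \<in> T"
    using assms(2) by (rule combsE) blast
  have "p + q = (\<Sum>f\<in>B. (a f + b f) * f)"
    unfolding a(1) b(1) by (simp add: sum.distrib distrib_right)
  moreover have "(\<Sum>f\<in>B. (a f + b f) * f) \<in> combs B T"
    using a(2) b(2) by (intro combsI) (auto dest!: subsetD[OF keys_add])
  ultimately show ?thesis by simp
qed

lemma combs_sum: "(\<And>x. x \<in> X \<Longrightarrow> g x \<in> combs B T) \<Longrightarrow> (\<Sum>x\<in>X. g x) \<in> combs B T"
  by (induction X rule: infinite_finite_induct) (auto simp: combs_zero combs_add)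

lemma combs_monom_mult_generator:
  assumes "finite B" "f \<in> B" "s + HT ord f \<in> T"
  shows "Poly_Mapping.single s c * f \<in> combs B T"
proof -
  have "(\<Sum>g\<in>B. (if g = f then Poly_Mapping.single s c else 0) * g) \<in> combs B T"
    using assms(3) by (intro combsI) (auto split: if_splits)
  then show ?thesis
    using assms(1,2) by (simp add: if_distrib[of "\<lambda>a. a * _"] cong: if_cong)
qed

lemma combs_monom_mult:
  assumes "p \<in> combs B T" "\<And>t. t \<in> T \<Longrightarrow> s + t \<in> T'"
  shows "Poly_Mapping.single s c * p \<in> combs B T'"
proof -
  obtain a where a: "p = (\<Sum>f\<in>B. a f * f)" "\<And>f s. f \<in> B \<Longrightarrow> s \<in> supp (a f) \<Longrightarrow> s + HT ord f \<in> T"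
    using assms(1) by (rule combsE) blast
  have "Poly_Mapping.single s c * p = (\<Sum>f\<in>B. (Poly_Mapping.single s c * a f) * f)"
    unfolding a(1) by (simp add: sum_distrib_left mult.assoc)
  moreover have "(\<Sum>f\<in>B. (Poly_Mapping.single s c * a f) * f) \<in> combs B T'"
  proof (rule combsI)
    fix f u assume f: "f \<in> B" and "u \<in> supp (Poly_Mapping.single s c * a f)"
    then obtain v where "v \<in> supp (a f)" "u = s + v" using supp_monom_mult by blast
    then show "u + HT ord f \<in> T'" using a(2)[OF f] assms(2) by (simp add: add.assoc)
  qed
  ultimately show ?thesis by simp
qed

lemma combs_supp:
  assumes "p \<in> combs B T" "u \<in> supp p"
  shows "\<exists>t\<in>T. (u, t) \<in> ord"
proof -
  obtain a where a: "p = (\<Sum>f\<in>B. a f * f)" "\<And>f s. f \<in> B \<Longrightarrow> s \<in> supp (a f) \<Longrightarrow> s + HT ord f \<in> T"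
    using assms(1) by (rule combsE) blast
  have "(\<Sum>f\<in>B. coef (a f * f) u) \<noteq> 0"
    using assms(2) unfolding a(1) by (simp add: in_keys_iff lookup_sum)
  then obtain f where f: "f \<in> B" "coef (a f * f) u \<noteq> 0"
    by (rule sum.not_neutral_contains_not_neutral)
  then have "u \<in> supp (a f * f)" by (simp add: in_keys_iff)
  then obtain s v where sv: "s \<in> supp (a f)" "v \<in> supp f" "u = s + v"
    using keys_mult[of "a f" f] by blast
  then have "f \<noteq> 0" by auto
  then have "(u, s + HT ord f) \<in> ord" unfolding sv(3) using sv(2) HT_greatest ord_add by blast
  then show ?thesis using a(2)[OF f(1) sv(1)] by blast
qed

lemma combs_bounded:
  assumes "finite B" "p \<in> combs B T" "p \<noteq> 0"
  obtains t where "t \<in> T" "p \<in> combs B {s. (s, t) \<in> ord}"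
proof -
  obtain a where a: "p = (\<Sum>f\<in>B. a f * f)" "\<And>f s. f \<in> B \<Longrightarrow> s \<in> supp (a f) \<Longrightarrow> s + HT ord f \<in> T"
    using assms(2) by (rule combsE) blast
  define A where "A = (\<Union>f\<in>B. (\<lambda>s. s + HT ord f) ` supp (a f))"
  have "finite A" unfolding A_def using assms(1) by auto
  moreover have "A \<noteq> {}"
  proof
    assume "A = {}"
    then have "a f = 0" if "f \<in> B" for f using that unfolding A_def by auto
    then show False using assms(3) a(1) by simp
  qed
  ultimately obtain t where t: "t \<in> A" "\<forall>s\<in>A. (s, t) \<in> ord"
    using finite_has_maximum by blast
  have "t \<in> T" using t(1) a(2) unfolding A_def by blast
  moreover have "p \<in> combs B {s. (s, t) \<in> ord}"
    unfolding a(1) using t(2) by (intro combsI) (auto simp: A_def)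
  ultimately show thesis by (rule that)
qed

lemma ideal_of_combs:
  assumes "finite B" "p \<in> ideal_of B"
  shows "p \<in> combs B UNIV"
proof -
  obtain k where "p = (\<Sum>f\<in>B. k f * f)"
    using ideal_of_image_explicit[of p id B] assms by auto
  then show ?thesis using combsI[of B k UNIV] by simp
qed

text \<open>
  Separates the monomial multiples of basis elements whose head-term is exactly \<open>t\<close>. Only they
  contribute to the coefficient of \<open>t\<close>.
\<close>

lemma combs_leading_part:
  assumes "finite B" "p \<in> combs B {s. (s, t) \<in> ord}"
  obtains k r where "p = (\<Sum>f\<in>head_divisors B t. Poly_Mapping.single (t - HT ord f) (k f) * f) + r"
    "r \<in> combs B {s. lt s t}" "coef p t = (\<Sum>f\<in>head_divisors B t. k f * HC ord f)"
proof -
  let ?D = "head_divisors B t"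
  obtain a where a: "p = (\<Sum>f\<in>B. a f * f)"
    "\<And>f s. f \<in> B \<Longrightarrow> s \<in> supp (a f) \<Longrightarrow> s + HT ord f \<in> {s. (s, t) \<in> ord}"
    using assms(2) by (rule combsE) blast
  define k where "k f = coef (a f) (t - HT ord f)" for f
  \<comment> \<open>The monomial of the cofactor of \<open>f\<close> that lifts the head-term of \<open>f\<close> to \<open>t\<close>.\<close>
  define b where "b f = (if f \<in> ?D then Poly_Mapping.single (t - HT ord f) (k f) else 0)" for f
  define r where "r = (\<Sum>f\<in>B. (a f - b f) * f)"
  have D: "?D \<subseteq> B" unfolding head_divisors_def by blast
  have eq: "t - HT ord f + HT ord f = t" if "f \<in> ?D" for f
    using that unfolding head_divisors_def by (intro pp_diff_add) blast
  have "p = (\<Sum>f\<in>B. b f * f) + r"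
    unfolding a(1) r_def by (simp add: sum.distrib[symmetric] distrib_right[symmetric])
  also have "(\<Sum>f\<in>B. b f * f) = (\<Sum>f\<in>?D. Poly_Mapping.single (t - HT ord f) (k f) * f)"
    by (rule sum.mono_neutral_cong_right[OF assms(1) D]) (auto simp: b_def)
  finally have p: "p = (\<Sum>f\<in>?D. Poly_Mapping.single (t - HT ord f) (k f) * f) + r" .
  have r: "r \<in> combs B {s. lt s t}"
    unfolding r_def
  proof (rule combsI)
    fix f s assume f: "f \<in> B" and s: "s \<in> supp (a f - b f)"
    have "s + HT ord f \<noteq> t"
    proof
      assume t: "s + HT ord f = t"
      then have "f \<in> ?D" "t - HT ord f = s" using f unfolding head_divisors_def by auto
      then have "coef (a f - b f) s = 0" unfolding b_def k_def by (simp add: lookup_minus)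
      then show False using s by (simp add: in_keys_iff)
    qed
    moreover from this have "s \<in> supp (a f)"
      using s eq[of f] unfolding b_def
      by (auto simp: in_keys_iff lookup_minus lookup_single split: if_splits)
    ultimately show "s + HT ord f \<in> {s. lt s t}"
      using a(2)[OF f] unfolding lt_def by blast
  qed
  have "t \<notin> supp r"
    using combs_supp[OF r] ord_antisym unfolding lt_def by blast
  then have "coef p t = (\<Sum>f\<in>?D. coef (Poly_Mapping.single (t - HT ord f) (k f) * f) t)"
    unfolding p by (simp add: lookup_add lookup_sum in_keys_iff)
  also have "\<dots> = (\<Sum>f\<in>?D. k f * HC ord f)"
  proof (rule sum.cong[OF refl])
    fix f assume "f \<in> ?D"
    then show "coef (Poly_Mapping.single (t - HT ord f) (k f) * f) t = k f * HC ord f"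
      using lookup_monom_mult_HT[of "t - HT ord f" "k f" f] eq by simp
  qed
  finally show thesis using p r by (intro that)
qed

text \<open>
  Every step subtracts multiples of basis elements whose head-term is a term of the polynomial being
  reduced, and such terms stay below \<open>t\<close>. Adding up the steps gives the combination.
\<close>

lemma combs_of_reduction_to_zero:
  assumes "finite B" "(step_using pred B)\<^sup>*\<^sup>* p 0" "\<And>u. u \<in> supp p \<Longrightarrow> lt u t"
  shows "p \<in> combs B {s. lt s t}"
  using assms(2,3)
proof (induction rule: converse_rtranclp_induct)
  case base
  show ?case by (rule combs_zero)
next
  case (step p q)
  obtain s P k where s: "s \<in> supp p" "P \<subseteq> head_divisors B s"
    "p - q = (\<Sum>f\<in>P. Poly_Mapping.single (s - HT ord f) (k f) * f)"
    "\<And>u. (u, s) \<notin> ord \<Longrightarrow> coef q u = coef p u"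
    using step.hyps(1) by (rule poly_stepE) blast
  have "lt s t" using s(1) step.prems by blast
  have "lt u t" if "u \<in> supp q" for u
  proof (cases "(u, s) \<in> ord")
    case True
    then show ?thesis using \<open>lt s t\<close> ord_lt_trans by blast
  next
    case False
    then have "u \<in> supp p" using s(4) that by (simp add: in_keys_iff)
    then show ?thesis by (rule step.prems)
  qed
  then have q: "q \<in> combs B {s. lt s t}" by (rule step.IH)
  have "p - q \<in> combs B {s. lt s t}"
    unfolding s(3)
  proof (intro combs_sum combs_monom_mult_generator assms(1))
    fix f assume "f \<in> P"
    then have "f \<in> B" "s - HT ord f + HT ord f = s"
      using s(2) unfolding head_divisors_def by (blast, intro pp_diff_add) blast
    then show "f \<in> B" "s - HT ord f + HT ord f \<in> {s. lt s t}" using \<open>lt s t\<close> by simp_all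
  qed
  from combs_add[OF this q] show ?case by simp
qed

end


section \<open>The completion procedure\<close>

locale completion = polynomial_reduction red ord
  for red :: "'a::comm_ring_1 set \<Rightarrow> 'a \<Rightarrow> 'a \<Rightarrow> bool" and ord :: "'n::finite pp rel" +
  fixes Groebner :: "'a set \<Rightarrow> 'a set"
    and h :: "('n, 'a) mpoly set \<Rightarrow> 'a \<Rightarrow> ('n, 'a) mpoly \<Rightarrow> 'a"
    and syz :: "('n, 'a) mpoly set \<Rightarrow> (('n, 'a) mpoly \<Rightarrow> 'a) set"
  assumes groebner: "Groebner_function red Groebner"
    and representation: "Groebner_representation ord Groebner h"
    and syzygies: "syzygy_generators ord syz"
begin

abbreviation "pass \<equiv> completion_step red ord Groebner h syz"
abbreviation "crit_polys B \<equiv> G_polys ord Groebner h B \<union> M_polys ord syz B"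

lemma groebner_weak: "finite C \<Longrightarrow> weak_GB red (ideal_of C) (Groebner C)"
  and groebner_finite: "finite C \<Longrightarrow> finite (Groebner C)"
  using groebner unfolding Groebner_function_def by blast+

lemma crit_polys_in_ideal: "q \<in> crit_polys B \<Longrightarrow> q \<in> ideal_of B"
  unfolding G_polys_def M_polys_def using crit_comb_in_ideal by blast

lemma crit_polys_finite:
  assumes "finite B" "0 \<notin> B"
  shows "finite (crit_polys B)"
proof -
  have fin: "finite F" if "F \<subseteq> B" for F
    using assms(1) that by (rule rev_finite_subset)
  have "finite (syz F)" if "F \<subseteq> B" "F \<noteq> {}" for F
    using syzygies fin[OF that(1)] that assms(2) unfolding syzygy_generators_def by blast
  then have "finite (\<Union>F\<in>Pow B - {{}}. crit_comb ord F ` syz F)"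
    using assms(1) by auto
  moreover have "M_polys ord syz B \<subseteq> (\<Union>F\<in>Pow B - {{}}. crit_comb ord F ` syz F)"
    unfolding M_polys_def by blast
  moreover have "finite (\<Union>F\<in>Pow B. (\<lambda>g. crit_comb ord F (h F g)) ` Groebner (HC ord ` F))"
    using assms(1) fin groebner_finite by auto
  moreover have "G_polys ord Groebner h B \<subseteq>
      (\<Union>F\<in>Pow B. (\<lambda>g. crit_comb ord F (h F g)) ` Groebner (HC ord ` F))"
    unfolding G_polys_def by blast
  ultimately show ?thesis using finite_subset by blast
qed

lemma roundE:
  assumes "pass B B'"
  obtains nf where "\<And>q. q \<in> crit_polys B \<Longrightarrow> normal_form_of pred B q (nf q)"
    "B' = B \<union> (nf ` crit_polys B - {0})"
  using assms unfolding completion_step_def by blast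

lemma round_exists: "\<exists>B'. pass B B'"
proof -
  have "\<forall>q. \<exists>c. normal_form_of pred B q c"
    using normal_form_exists[OF poly_red_wf] by blast
  then obtain nf where "\<And>q. normal_form_of pred B q (nf q)" by metis
  then show ?thesis unfolding completion_step_def by blast
qed

lemma round_invariants:
  assumes "pass B B'" "finite B" "0 \<notin> B"
  shows "finite B'" "0 \<notin> B'" "B \<subseteq> B'" "ideal_of B' = ideal_of B"
proof -
  obtain nf where nf: "\<And>q. q \<in> crit_polys B \<Longrightarrow> normal_form_of pred B q (nf q)"
    and B': "B' = B \<union> (nf ` crit_polys B - {0})"
    using assms(1) by (rule roundE) blast
  show "finite B'" "0 \<notin> B'" "B \<subseteq> B'"
    unfolding B' using assms(2,3) crit_polys_finite by auto
  have "nf q \<in> ideal_of B" if q: "q \<in> crit_polys B" for q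
  proof -
    have "q - nf q \<in> ideal_of B"
      using steps_congruent[where red = pred, OF poly_step_congruent] nf[OF q]
      unfolding normal_form_of_def by blast
    from ideal_of_diff[OF crit_polys_in_ideal[OF q] this] show ?thesis by simp
  qed
  then have "B' \<subseteq> ideal_of B" unfolding B' using ideal_of_base by auto
  then show "ideal_of B' = ideal_of B"
    using ideal_of_subset ideal_of_mono[OF \<open>B \<subseteq> B'\<close>] by blast
qed

lemma rounds_invariants:
  assumes "pass\<^sup>*\<^sup>* B B'" "finite B" "0 \<notin> B"
  shows "finite B' \<and> 0 \<notin> B' \<and> ideal_of B' = ideal_of B"
  using assms(1)
proof induction
  case base
  show ?case using assms(2,3) by simp
next
  case (step B\<^sub>1 B\<^sub>2)
  then show ?case using round_invariants[of B\<^sub>1 B\<^sub>2] by simp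
qed

text \<open>
  Otherwise the normal form of the G-polynomial belonging to \<open>g\<close> keeps \<open>g\<close> as its head-coefficient at the
  least common multiple; having been added to the basis, it reduces \<open>g\<close>.
\<close>

lemma G_polys_make_head_coefs_reduce:
  assumes "pass B B'" "finite B" "0 \<notin> B" "F \<subseteq> B" "F \<noteq> {}"
    and g: "g \<in> Groebner (HC ord ` F)" "g \<noteq> 0"
  shows "reduces red (HC ord ` head_divisors B' (lcm_pp (HT ord ` F))) g"
proof (rule ccontr)
  let ?t = "lcm_pp (HT ord ` F)"
  assume irred: "\<not> ?thesis"
  obtain nf where nf: "\<And>q. q \<in> crit_polys B \<Longrightarrow> normal_form_of pred B q (nf q)"
    and B': "B' = B \<union> (nf ` crit_polys B - {0})"
    using assms(1) by (rule roundE) blast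
  have F: "finite F" "0 \<notin> F"
    using assms(2-4) finite_subset by blast+
  define q where "q = crit_comb ord F (h F g)"
  have q: "q \<in> crit_polys B"
    unfolding q_def G_polys_def using assms(4,5) F(1) g(1) by blast
  have "coef q ?t = (\<Sum>p\<in>F. h F g p * HC ord p)"
    unfolding q_def using F assms(5) by (intro lookup_crit_comb)
  also have "\<dots> = g"
    using representation F assms(5) g(1) unfolding Groebner_representation_def by metis
  finally have coef: "coef q ?t = g" .
  have "B \<subseteq> B'" unfolding B' by blast
  then have "HC ord ` head_divisors B ?t \<subseteq> HC ord ` head_divisors B' ?t"
    by (intro image_mono head_divisors_mono) (auto intro: exI[of _ 0])
  then have "\<not> reduces red (HC ord ` head_divisors B ?t) (coef q ?t)"
    using irred reduces_mono coef by metis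
  moreover have "(u, ?t) \<in> ord" if "u \<in> supp q" for u
    using supp_crit_comb[OF F(1) assms(5) F(2)] that unfolding q_def by blast
  moreover have "(step_using pred B)\<^sup>*\<^sup>* q (nf q)"
    using nf[OF q] unfolding normal_form_of_def by blast
  ultimately have n: "coef (nf q) ?t = g" "\<And>u. u \<in> supp (nf q) \<Longrightarrow> (u, ?t) \<in> ord"
    using steps_keep_irreducible_coef[of B q "nf q" ?t] coef by blast+
  then have "?t \<in> supp (nf q)" using g(2) by (simp add: in_keys_iff)
  then have HT: "HT ord (nf q) = ?t" using n(2) by (intro HT_unique)
  have "nf q \<in> B'" unfolding B' using q n(1) g(2) by auto
  then have "nf q \<in> head_divisors B' ?t"
    unfolding head_divisors_def using HT by (auto intro: exI[of _ 0])
  moreover have "HC ord (nf q) = g" unfolding HC_def HT by (rule n(1))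
  ultimately have "{g} \<subseteq> HC ord ` head_divisors B' ?t" by blast
  from reducesI[where red = red, OF multiple_reduces[OF g(2) dvd_refl] this] irred
  show False by simp
qed

text \<open>
  Transitivity of reducibility in the coefficient ring transfers the preceding lemma from the elements
  of the Groebner basis to everything that reduces using them.
\<close>

lemma groebner_reducible_imp_head_coefs_reduce:
  assumes "pass B B'" "finite B" "0 \<notin> B" "F \<subseteq> B" "F \<noteq> {}"
    and "reduces red (Groebner (HC ord ` F)) c"
  shows "reduces red (HC ord ` head_divisors B' (lcm_pp (HT ord ` F))) c"
proof -
  let ?C = "HC ord ` head_divisors B' (lcm_pp (HT ord ` F))"
  note B' = round_invariants[OF assms(1-3)]
  have "finite F" using assms(2,4) finite_subset by blast
  obtain f where "f \<in> F" using assms(5) by blast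
  moreover have "\<exists>u. lcm_pp (HT ord ` F) = u + HT ord f"
    using \<open>finite F\<close> \<open>f \<in> F\<close> by (intro lcm_pp_divisible) auto
  ultimately have "f \<in> head_divisors B' (lcm_pp (HT ord ` F))"
    using assms(4) B'(3) unfolding head_divisors_def by blast
  then have "?C \<noteq> {}" by blast
  moreover have "finite ?C" using B'(1) unfolding head_divisors_def by simp
  moreover have "Groebner (HC ord ` F) \<noteq> {}"
    using assms(6) unfolding reduces_def step_using_def by blast
  moreover have "finite (Groebner (HC ord ` F))"
    using groebner_finite \<open>finite F\<close> by blast
  ultimately show ?thesis
    using assms(6) G_polys_make_head_coefs_reduce[OF assms(1-5)] reduces_trans by metis
qed

lemma completion_stops:
  assumes "finite (Bs 0)" "0 \<notin> Bs 0" "\<And>i. pass (Bs i) (Bs (Suc i))"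
  shows "\<exists>N. Bs (Suc N) = Bs N"
proof (rule ccontr)
  assume "\<not> ?thesis"
  then have neq: "Bs (Suc N) \<noteq> Bs N" for N by blast
  have inv: "finite (Bs i) \<and> 0 \<notin> Bs i" for i
  proof (induction i)
    case 0
    show ?case using assms(1,2) by simp
  next
    case (Suc i)
    then show ?case using round_invariants[OF assms(3)[of i]] by blast
  qed
  have mono: "Bs i \<subseteq> Bs j" if "i \<le> j" for i j
    using lift_Suc_mono_le[of Bs i j] round_invariants(3)[OF assms(3)] inv that by blast
  \<comment> \<open>A polynomial added in pass \<open>i\<close> is itself a normal form using \<open>Bs i\<close>.\<close>
  have "\<exists>f. f \<in> Bs (Suc i) \<and> f \<noteq> 0 \<and> \<not> reduces pred (Bs i) f" for i
  proof -
    obtain nf where nf: "\<And>q. q \<in> crit_polys (Bs i) \<Longrightarrow> normal_form_of pred (Bs i) q (nf q)"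
      and B': "Bs (Suc i) = Bs i \<union> (nf ` crit_polys (Bs i) - {0})"
      using assms(3) by (rule roundE) blast
    obtain q where "q \<in> crit_polys (Bs i)" "nf q \<noteq> 0"
      using neq[of i] B' by blast
    then show ?thesis using nf B' unfolding normal_form_of_def by blast
  qed
  then obtain f where f: "\<And>i. f i \<in> Bs (Suc i)" "\<And>i. f i \<noteq> 0" "\<And>i. \<not> reduces pred (Bs i) (f i)"
    by metis
  obtain r :: "nat \<Rightarrow> nat" where r: "strict_mono r"
    "\<And>i j. i \<le> j \<Longrightarrow> \<exists>u. HT ord (f (r j)) = u + HT ord (f (r i))"
    using Dickson[of "\<lambda>i. HT ord (f i)"] by blast
  obtain M where M: "\<And>i. HC ord (f (r i)) \<in> ideal_of ((\<lambda>i. HC ord (f (r i))) ` {..<M})"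
    using ideal_sequence_stabilises[of "\<lambda>i. HC ord (f (r i))"] by blast
  define F where "F = (\<lambda>i. f (r i)) ` {..<M}"
  have HCF: "HC ord ` F = (\<lambda>i. HC ord (f (r i))) ` {..<M}"
    unfolding F_def by (simp add: image_image)
  have "M \<noteq> 0"
    using M[of 0] HC_nonzero[OF f(2)] by (intro notI) (simp add: ideal_of_empty)
  then have "F \<noteq> {}" unfolding F_def by auto
  have F: "F \<subseteq> Bs (r M)"
  proof
    fix p assume "p \<in> F"
    then obtain i where i: "i < M" "p = f (r i)" unfolding F_def by blast
    then have "Suc (r i) \<le> r M" using r(1) by (simp add: strict_mono_def Suc_le_eq)
    then show "p \<in> Bs (r M)" using f(1) mono i(2) by blast
  qed
  have "finite F" unfolding F_def by simp
  \<comment> \<open>The pass from \<open>Bs (r M)\<close> to \<open>Bs j\<close> treats the G-polynomials of \<open>F\<close>, and \<open>f (r j)\<close> was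
    irreducible by a basis at least as late as \<open>Bs j\<close>.\<close>
  define j where "j = Suc (r M)"
  have "M \<le> r M" "j \<le> r j" using r(1) by (simp_all add: strict_mono_imp_increasing)
  then have "M \<le> j" unfolding j_def by simp
  let ?p = "f (r j)" and ?t = "lcm_pp (HT ord ` F)"
  have "HC ord ?p \<in> ideal_of (HC ord ` F)" using M[of j] HCF by simp
  then have "reduces red (Groebner (HC ord ` F)) (HC ord ?p)"
    using weak_GB_reduces[OF groebner_weak] \<open>finite F\<close> HC_nonzero[OF f(2)] by blast
  then have red: "reduces red (HC ord ` head_divisors (Bs j) ?t) (HC ord ?p)"
    unfolding j_def using groebner_reducible_imp_head_coefs_reduce[OF assms(3)] inv F \<open>F \<noteq> {}\<close> by blast
  have "\<exists>u. HT ord ?p = u + ?t"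
    using \<open>finite F\<close> \<open>F \<noteq> {}\<close>
  proof (intro lcm_pp_least)
    fix t assume "t \<in> HT ord ` F"
    then obtain i where i: "i < M" "t = HT ord (f (r i))" unfolding F_def by auto
    then have "i \<le> j" using \<open>M \<le> j\<close> by simp
    then show "\<exists>u. HT ord ?p = u + t" using r(2) i(2) by blast
  qed auto
  then have "HC ord ` head_divisors (Bs j) ?t \<subseteq> HC ord ` head_divisors (Bs (r j)) (HT ord ?p)"
    using mono[OF \<open>j \<le> r j\<close>] by (intro image_mono head_divisors_mono)
  from reduces_mono[OF red this]
  have "reduces red (HC ord ` head_divisors (Bs (r j)) (HT ord ?p)) (coef ?p (HT ord ?p))"
    unfolding HC_def .
  then have "reduces pred (Bs (r j)) ?p"
    using poly_reduces_iff HT_in_supp[OF f(2)] inv by blast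
  then show False using f(3) by blast
qed

end

locale completed_basis = completion red ord Groebner h syz
  for red :: "'a::comm_ring_1 set \<Rightarrow> 'a \<Rightarrow> 'a \<Rightarrow> bool" and ord :: "'n::finite pp rel"
    and Groebner :: "'a set \<Rightarrow> 'a set"
    and h :: "('n, 'a) mpoly set \<Rightarrow> 'a \<Rightarrow> ('n, 'a) mpoly \<Rightarrow> 'a"
    and syz :: "('n, 'a) mpoly set \<Rightarrow> (('n, 'a) mpoly \<Rightarrow> 'a) set" +
  fixes B :: "('n, 'a) mpoly set"
  assumes final: "pass B B" and finite_basis: "finite B" and nonzero_basis: "0 \<notin> B"
begin

text \<open>
  A nonzero normal form would belong to the basis and therefore reduce by itself.
\<close>

lemma crit_polys_reduce_to_zero:
  assumes "q \<in> crit_polys B"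
  shows "(step_using pred B)\<^sup>*\<^sup>* q 0"
proof -
  obtain nf where nf: "\<And>q. q \<in> crit_polys B \<Longrightarrow> normal_form_of pred B q (nf q)"
    and B: "B = B \<union> (nf ` crit_polys B - {0})"
    using final by (rule roundE) blast
  have q: "(step_using pred B)\<^sup>*\<^sup>* q (nf q)" "\<not> reduces pred B (nf q)"
    using nf[OF assms] unfolding normal_form_of_def by blast+
  have "nf q = 0"
  proof (rule ccontr)
    assume n: "nf q \<noteq> 0"
    then have "nf q \<in> B" using B assms by blast
    then have "nf q \<in> head_divisors B (HT ord (nf q))"
      unfolding head_divisors_def by (auto intro: exI[of _ 0])
    then have "{HC ord (nf q)} \<subseteq> HC ord ` head_divisors B (HT ord (nf q))" by blast
    from reducesI[where red = red, OF multiple_reduces[OF HC_nonzero[OF n] dvd_refl] this]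
    have "reduces red (HC ord ` head_divisors B (HT ord (nf q))) (coef (nf q) (HT ord (nf q)))"
      unfolding HC_def by simp
    then show False
      using q(2) poly_reduces_iff[OF nonzero_basis] HT_in_supp[OF n] by blast
  qed
  then show ?thesis using q(1) by simp
qed

text \<open>
  The coefficients form a syzygy of the head-coefficients of \<open>head_divisors B t\<close>, so the combination is
  a combination of the M-polynomials of this set, multiplied by terms that lift their least common multiple
  to \<open>t\<close>. M-polynomials have only terms strictly below the least common multiple and reduce to 0.
\<close>

lemma syzygy_combination_below:
  assumes "(\<Sum>f\<in>head_divisors B t. k f * HC ord f) = 0"
  shows "(\<Sum>f\<in>head_divisors B t. Poly_Mapping.single (t - HT ord f) (k f) * f) \<in> combs B {s. lt s t}"
proof (cases "head_divisors B t = {}")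
  case True
  then show ?thesis by (simp add: combs_zero)
next
  case False
  let ?D = "head_divisors B t"
  let ?l = "lcm_pp (HT ord ` ?D)"
  have D: "?D \<subseteq> B" "finite ?D" "0 \<notin> ?D"
    using finite_basis nonzero_basis unfolding head_divisors_def by auto
  have l: "?l - HT ord f + HT ord f = ?l" if "f \<in> ?D" for f
    using D(2) that by (intro pp_diff_add lcm_pp_divisible) auto
  have "\<exists>u. t = u + ?l"
    using D(2) False by (intro lcm_pp_least) (auto simp: head_divisors_def)
  then have t: "t - ?l + ?l = t" by (rule pp_diff_add)
  have syz: "(\<Sum>f\<in>?D. A f * HC ord f) = 0" if "A \<in> syz ?D" for A
    using syzygies D False that unfolding syzygy_generators_def by blast
  have "\<exists>c. \<forall>f\<in>?D. k f = (\<Sum>A\<in>syz ?D. c A * A f)"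
    using spec[OF syzygies[unfolded syzygy_generators_def], of ?D] assms D False by simp
  then obtain c where c: "\<forall>f\<in>?D. k f = (\<Sum>A\<in>syz ?D. c A * A f)" by (rule exE)
  have "Poly_Mapping.single (t - HT ord f) (k f) * f =
      (\<Sum>A\<in>syz ?D. Poly_Mapping.single (t - ?l) (c A) * (Poly_Mapping.single (?l - HT ord f) (A f) * f))"
    if f: "f \<in> ?D" for f
  proof -
    have "t - HT ord f = (t - ?l) + (?l - HT ord f)"
      using add_diff_cancel_right'[of "(t - ?l) + (?l - HT ord f)" "HT ord f"] t l[OF f]
      by (simp only: add.assoc)
    then show ?thesis
      unfolding bspec[OF c f]
      by (simp add: mult.assoc[symmetric] mult_single sum_distrib_right[symmetric] single_sum)
  qed
  then have "(\<Sum>f\<in>?D. Poly_Mapping.single (t - HT ord f) (k f) * f) =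
      (\<Sum>f\<in>?D. \<Sum>A\<in>syz ?D. Poly_Mapping.single (t - ?l) (c A) * (Poly_Mapping.single (?l - HT ord f) (A f) * f))"
    by (rule sum.cong[OF refl])
  also have "\<dots> = (\<Sum>A\<in>syz ?D. Poly_Mapping.single (t - ?l) (c A) * crit_comb ord ?D A)"
    by (subst sum.swap) (simp add: crit_comb_def sum_distrib_left)
  also have "\<dots> \<in> combs B {s. lt s t}"
  proof (rule combs_sum)
    fix A assume A: "A \<in> syz ?D"
    have "coef (crit_comb ord ?D A) ?l = 0"
      using lookup_crit_comb[OF D(2) False D(3)] syz[OF A] by simp
    then have "lt u ?l" if "u \<in> supp (crit_comb ord ?D A)" for u
      using supp_crit_comb[OF D(2) False D(3)] that unfolding lt_def by (auto simp: in_keys_iff)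
    moreover have "crit_comb ord ?D A \<in> crit_polys B"
      unfolding M_polys_def using A D False by blast
    ultimately have "crit_comb ord ?D A \<in> combs B {s. lt s ?l}"
      using finite_basis crit_polys_reduce_to_zero combs_of_reduction_to_zero by blast
    then show "Poly_Mapping.single (t - ?l) (c A) * crit_comb ord ?D A \<in> combs B {s. lt s t}"
      by (rule combs_monom_mult) (use lt_add[of _ ?l "t - ?l"] t in simp)
  qed
  finally show ?thesis .
qed

text \<open>
  Among all representations of \<open>p\<close> by the basis, descend to one whose largest head-term \<open>t\<close> is minimal:
  as long as the coefficient of \<open>p\<close> at \<open>t\<close> vanishes, the leading part is a syzygy combination and can be
  replaced.
\<close>

lemma ideal_member_has_head_coef:
  assumes "p \<in> ideal_of B" "p \<noteq> 0"
  shows "\<exists>t\<in>supp p. coef p t \<in> ideal_of (HC ord ` head_divisors B t)"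
proof -
  have "\<exists>t\<in>supp p. coef p t \<in> ideal_of (HC ord ` head_divisors B t)"
    if "p \<in> combs B {s. (s, t) \<in> ord}" for t
    using that
  proof (induction t rule: wf_induct_rule[OF ord_wf])
    case (1 t)
    obtain k r where k: "p = (\<Sum>f\<in>head_divisors B t. Poly_Mapping.single (t - HT ord f) (k f) * f) + r"
      and r: "r \<in> combs B {s. lt s t}"
      and c: "coef p t = (\<Sum>f\<in>head_divisors B t. k f * HC ord f)"
      using finite_basis 1(2) by (rule combs_leading_part)
    show ?case
    proof (cases "coef p t = 0")
      case True
      then have "(\<Sum>f\<in>head_divisors B t. k f * HC ord f) = 0" using c by simp
      from combs_add[OF syzygy_combination_below[OF this] r]
      have "p \<in> combs B {s. lt s t}" using k by simp
      then obtain s where "s \<in> {s. lt s t}" "p \<in> combs B {u. (u, s) \<in> ord}"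
        using combs_bounded[OF finite_basis _ assms(2)] by blast
      then show ?thesis using 1(1)[of s] unfolding lt_def by simp
    next
      case False
      have "coef p t \<in> ideal_of (HC ord ` head_divisors B t)"
        unfolding c by (intro ideal_of_sum ideal_of_mult ideal_of_base) blast
      then show ?thesis using False by (intro bexI[of _ t]) (simp_all add: in_keys_iff)
    qed
  qed
  moreover obtain t where "p \<in> combs B {s. (s, t) \<in> ord}"
    using combs_bounded[OF finite_basis ideal_of_combs[OF finite_basis assms(1)] assms(2)] by blast
  ultimately show ?thesis by blast
qed

text \<open>
  In a final basis the pass changes nothing, and the least common multiple of the head-terms of
  \<open>head_divisors B t\<close> divides \<open>t\<close>, so it has no head divisors besides these.
\<close>

lemma groebner_reducible_imp_head_reducible:
  assumes "head_divisors B t \<noteq> {}" "reduces red (Groebner (HC ord ` head_divisors B t)) c"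
  shows "reduces red (HC ord ` head_divisors B t) c"
proof -
  let ?D = "head_divisors B t"
  have D: "?D \<subseteq> B" "finite ?D"
    using finite_basis unfolding head_divisors_def by auto
  have "\<exists>u. t = u + lcm_pp (HT ord ` ?D)"
    using D(2) assms(1) by (intro lcm_pp_least) (auto simp: head_divisors_def)
  then have "HC ord ` head_divisors B (lcm_pp (HT ord ` ?D)) \<subseteq> HC ord ` ?D"
    by (intro image_mono head_divisors_mono) simp_all
  moreover have "reduces red (HC ord ` head_divisors B (lcm_pp (HT ord ` ?D))) c"
    by (rule groebner_reducible_imp_head_coefs_reduce[OF final finite_basis nonzero_basis D(1) assms])
  ultimately show ?thesis by (metis reduces_mono)
qed

lemma completed_basis_weak: "weak_GB pred (ideal_of B) B"
  unfolding weak_GB_def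
proof (intro conjI ballI refl)
  fix p assume p: "p \<in> ideal_of B"
  obtain q where q: "normal_form_of pred B p q"
    using normal_form_exists[OF poly_red_wf] by blast
  then have "p - q \<in> ideal_of B"
    using steps_congruent[where red = pred, OF poly_step_congruent] unfolding normal_form_of_def by blast
  from ideal_of_diff[OF p this] have "q \<in> ideal_of B" by simp
  have "q = 0"
  proof (rule ccontr)
    assume "q \<noteq> 0"
    then obtain t where t: "t \<in> supp q" "coef q t \<in> ideal_of (HC ord ` head_divisors B t)"
      using ideal_member_has_head_coef[OF \<open>q \<in> ideal_of B\<close>] by blast
    have "coef q t \<noteq> 0" using t(1) by (simp add: in_keys_iff)
    then have "head_divisors B t \<noteq> {}" using t(2) by (auto simp: ideal_of_empty)
    moreover have "finite (HC ord ` head_divisors B t)"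
      using finite_basis unfolding head_divisors_def by simp
    ultimately have "reduces red (HC ord ` head_divisors B t) (coef q t)"
      using groebner_reducible_imp_head_reducible weak_GB_reduces[OF groebner_weak] t(2)
        \<open>coef q t \<noteq> 0\<close> by blast
    then have "reduces pred B q"
      using poly_reduces_iff[OF nonzero_basis] t(1) by blast
    then show False using q unfolding normal_form_of_def by blast
  qed
  then show "normal_form_of pred B p 0" using q by simp
qed

text \<open>
  Two distinct normal forms of congruent polynomials would differ at a term \<open>t\<close> where their
  coefficients are congruent modulo the ideal of head-coefficients. Both coefficients are their own
  normal forms using the Groebner basis of that ideal.
\<close>

lemma completed_basis_residue_class_normal_forms:
  assumes "\<And>C. finite C \<Longrightarrow> residue_class_normal_forms red (ideal_of C) (Groebner C)"
  shows "residue_class_normal_forms pred (ideal_of B) B"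
  unfolding residue_class_normal_forms_def
proof (intro allI impI, elim conjE)
  fix a b p q
  assume ab: "a - b \<in> ideal_of B" and p: "normal_form_of pred B a p" and q: "normal_form_of pred B b q"
  show "p = q"
  proof (rule ccontr)
    assume neq: "p \<noteq> q"
    have "a - p \<in> ideal_of B" "b - q \<in> ideal_of B"
      using steps_congruent[where red = pred, OF poly_step_congruent] p q
      unfolding normal_form_of_def by blast+
    from ideal_of_add[OF ideal_of_diff[OF ab this(1)] this(2)]
    have "p - q \<in> ideal_of B" by (simp add: algebra_simps)
    then obtain t where t: "t \<in> supp (p - q)"
      "coef (p - q) t \<in> ideal_of (HC ord ` head_divisors B t)"
      using ideal_member_has_head_coef neq by (metis right_minus_eq)
    let ?C = "HC ord ` head_divisors B t"
    have "coef (p - q) t \<noteq> 0" using t(1) by (simp add: in_keys_iff)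
    then have ne: "head_divisors B t \<noteq> {}" using t(2) by (auto simp: ideal_of_empty)
    have irred: "\<not> reduces red (Groebner ?C) (coef r t)" if r: "\<not> reduces pred B r" for r
    proof
      assume *: "reduces red (Groebner ?C) (coef r t)"
      then have "t \<in> supp r" using zero_irreducible by (auto simp: in_keys_iff)
      moreover have "reduces red ?C (coef r t)"
        using ne * by (rule groebner_reducible_imp_head_reducible)
      ultimately show False using r poly_reduces_iff[OF nonzero_basis] by blast
    qed
    have "normal_form_of red (Groebner ?C) (coef r t) (coef r t)" if "\<not> reduces pred B r" for r
      unfolding normal_form_of_def using irred[OF that] by simp
    then have "normal_form_of red (Groebner ?C) (coef p t) (coef p t)"
      "normal_form_of red (Groebner ?C) (coef q t) (coef q t)"
      using p q unfolding normal_form_of_def[of pred] by blast+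
    moreover have "finite ?C" using finite_basis unfolding head_divisors_def by simp
    ultimately have "coef p t = coef q t"
      using assms t(2) unfolding residue_class_normal_forms_def lookup_minus by blast
    then show False using \<open>coef (p - q) t \<noteq> 0\<close> by (simp add: lookup_minus)
  qed
qed

end

theorem mainTheorem6:
  fixes red :: "'a::comm_ring_1 set \<Rightarrow> 'a \<Rightarrow> 'a \<Rightarrow> bool"
    and ord :: "'n::finite pp rel"
    and Groebner :: "'a set \<Rightarrow> 'a set"
    and h :: "('n, 'a) mpoly set \<Rightarrow> 'a \<Rightarrow> ('n, 'a) mpoly \<Rightarrow> 'a"
    and syz :: "('n, 'a) mpoly set \<Rightarrow> (('n, 'a) mpoly \<Rightarrow> 'a) set"
    and B\<^sub>0 :: "('n, 'a) mpoly set"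
  assumes "reduction_ring red"
    and "admissible_order ord"
    and "Groebner_function red Groebner"
    and "Groebner_representation ord Groebner h"
    and "syzygy_generators ord syz"
    and "finite B\<^sub>0" and "0 \<notin> B\<^sub>0"
  shows "completion_terminates red ord Groebner h syz B\<^sub>0 \<and>
    (\<forall>B. final_basis red ord Groebner h syz B\<^sub>0 B \<longrightarrow>
      weak_GB (poly_red red ord) (ideal_of B\<^sub>0) B \<and>
      ((\<forall>C. finite C \<longrightarrow> strong_GB red (ideal_of C) (Groebner C) \<and>
                        residue_class_normal_forms red (ideal_of C) (Groebner C)) \<longrightarrow>
        strong_GB (poly_red red ord) (ideal_of B\<^sub>0) B \<and>
        residue_class_normal_forms (poly_red red ord) (ideal_of B\<^sub>0) B))"
proof (intro conjI allI impI)
  interpret completion red ord Groebner h syz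
    using assms(1-5)
    by (intro completion.intro polynomial_reduction.intro term_order.intro completion_axioms.intro)
  show "completion_terminates red ord Groebner h syz B\<^sub>0"
    unfolding completion_terminates_def
  proof (intro conjI allI impI)
    fix B assume "pass\<^sup>*\<^sup>* B\<^sub>0 B"
    from rounds_invariants[OF this assms(6,7)] show "finite B" by blast
    show "\<exists>B'. pass B B'" by (rule round_exists)
  next
    fix Bs assume Bs: "Bs 0 = B\<^sub>0 \<and> (\<forall>i. pass (Bs i) (Bs (Suc i)))"
    show "\<exists>N. Bs (Suc N) = Bs N"
      by (rule completion_stops) (use Bs assms(6,7) in auto)
  qed
  fix B assume "final_basis red ord Groebner h syz B\<^sub>0 B"
  then have B: "pass\<^sup>*\<^sup>* B\<^sub>0 B" "pass B B" unfolding final_basis_def by blast+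
  have inv: "finite B" "0 \<notin> B" "ideal_of B = ideal_of B\<^sub>0"
    using rounds_invariants[OF B(1) assms(6,7)] by blast+
  interpret completed_basis red ord Groebner h syz B
    using B(2) inv by unfold_locales
  show "weak_GB pred (ideal_of B\<^sub>0) B"
    using completed_basis_weak inv(3) by simp
  assume strong: "\<forall>C. finite C \<longrightarrow> strong_GB red (ideal_of C) (Groebner C) \<and>
    residue_class_normal_forms red (ideal_of C) (Groebner C)"
  then have res: "residue_class_normal_forms pred (ideal_of B) B"
    by (intro completed_basis_residue_class_normal_forms) blast
  then show "residue_class_normal_forms pred (ideal_of B\<^sub>0) B" using inv(3) by simp
  \<comment> \<open>Uniqueness is the case of equal polynomials, which are congruent.\<close>
  have "\<exists>!c. normal_form_of pred B a c" for a
  proof (rule ex_ex1I)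
    show "\<exists>c. normal_form_of pred B a c"
      using poly_red_wf by (rule normal_form_exists)
    fix c d assume "normal_form_of pred B a c" "normal_form_of pred B a d"
    moreover have "a - a \<in> ideal_of B" by (simp add: ideal_of_zero)
    ultimately show "c = d" using res unfolding residue_class_normal_forms_def by blast
  qed
  then show "strong_GB pred (ideal_of B\<^sub>0) B" unfolding strong_GB_def using inv(3) by simp
qed

end
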